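(* Let $g:\mathbb{R}^d\to\mathbb{R}^d$ be such that $g'(x)$ is symmetric and $h(x):=x-g(x)$ satisfies Assumption (H) stated in the context, with associated $x^*$ and constants $\hat\rho,\hat\kappa,\mu,L>0$. Let $\{x_k\}$ and $\{r_k\}$ denote the iterates and residuals of the restarted short-term recurrence Anderson mixing method (restarted ST-AM, described in the context) applied to $x=g(x)$, let $A:=I-g'(x^* )$, $\theta_k:=\|I-\beta_kA\|_2$, and let $\theta\in\bigl[\frac{L-\mu}{L+\mu},1\bigr)$ be a constant. For $k=0,1,\dots$, suppose $\beta_k$ is chosen such that $\theta_k\le\theta$. Then the following hold. 1. For the Type-I method, if $x_0$ is sufficiently close to $x^*$, then $$\|x_{k+1}-x^*\|_A\le2\theta_k\left(\frac{\sqrt{L/\mu}-1}{\sqrt{L/\mu}+1}\right)^{m_k}\|x_{k-m_k}-x^*\|_A+\hat\kappa\,\mathcal{O}(\|x_{k-m_k}-x^*\|_2^2).$$ 2. For the Type-II method, if $x_0$ is sufficiently close to $x^*$, then $$\|r_{k+1}\|_2\le2\theta_k\left(\frac{\sqrt{L/\mu}-1}{\sqrt{L/\mu}+1}\right)^{m_k}\|r_{k-m_k}\|_2+\hat\kappa\,\mathcal{O}(\|x_{k-m_k}-x^*\|_2^2).$$ 3. For either method, if $g'(x)$ is symmetric, $h$ satisfies Assumption (H), $\beta_j$ is chosen such that $\theta_j\le\theta$ for all $j=0,1,\dots$, $x_0$ is sufficiently close to $x^*$, and $m_k=d$, then $\|x_{k+1}-x^*\|_2=\hat\kappa\,\mathcal{O}(\|x_{k-m_k}-x^*\|_2^2)$,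 i.e. $(d+1)$-step quadratic convergence.
   Context: Notation. $\|x\|_A=(x^{\mathrm T}Ax)^{1/2}$ for symmetric positive definite $A$; $\mathcal{S}(B)=(B+B^{\mathrm T})/2$. A real square matrix $B$ is positive definite if all eigenvalues of $\mathcal{S}(B)$ are positive. Symmetry of $g'(x)$ is meant for all $x$ in the neighbourhood of $x^*$ where $g$ is differentiable. Assumption (H) on $h(x)=x-g(x)$: (i) there exists $x^*$ with $h(x^* )=0$; (ii) $h$ is Lipschitz continuously differentiable in a neighbourhood of $x^*$; (iii) $h'(x^* )$ is positive definite. Consequently there are positive constants $\hat\rho,\hat\kappa,\mu,L$, which are fixed, such that for all $x\in\mathcal{B}_{\hat\rho}(x^* ):=\{z:\|z-x^*\|_2\le\hat\rho\}$ and all $y\in\mathbb{R}^d$: $\mu\|y\|_2\le\|h'(x)y\|_2\le L\|y\|_2$; $\mu\|y\|_2^2\le y^{\mathrm T}h'(x)y\le L\|y\|_2^2$; $\|h(x)-h'(x^* )(x-x^* )\|_2\le\frac12\hat\kappa\|x-x^*\|_2^2$. Restarted ST-AM. Inputs: $x_0\in\mathbb{R}^d$, mixing parameters $\beta_k>0$, an integer $m$ with $0<m\le d$, $\tau\in(0,1)$, $\eta>0$. Put $v_j:=p_j$ for the Type-I method and $v_j:=q_j$ for the Type-II method. Set $m_0=0$. For $k=0,1,\dots$ until convergence (i.e. as long as $r_k\ne0$): (1) $r_k:=g(x_k)-x_k$. If $m_k>m$ or $\|r_k\|_2>\eta\|r_{k-m_k}\|_2$, reset $m_k:=0$. (2)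 If $m_k>0$: set $p_k:=x_k-x_{k-1}$, $q_k:=r_k-r_{k-1}$; for $j=\max\{1,m_k-2\},\dots,m_k-1$ successively set $\zeta_k^{(j)}:=\frac{v_{k-m_k+j}^{\mathrm T}q_k}{v_{k-m_k+j}^{\mathrm T}q_{k-m_k+j}}$ and replace $p_k$ by $p_k-p_{k-m_k+j}\zeta_k^{(j)}$ and $q_k$ by $q_k-q_{k-m_k+j}\zeta_k^{(j)}$. Then, if $|v_k^{\mathrm T}q_k|<\tau|v_{k-m_k+1}^{\mathrm T}q_{k-m_k+1}|$, reset $m_k:=0$. (3) Set $\bar x_k:=x_k$, $\bar r_k:=r_k$; for $j=\max\{1,m_k-1\},\dots,m_k$ (no step if $m_k=0$) successively set $\Gamma_k^{(j)}:=\frac{v_{k-m_k+j}^{\mathrm T}\bar r_k}{v_{k-m_k+j}^{\mathrm T}q_{k-m_k+j}}$ and replace $\bar x_k$ by $\bar x_k-p_{k-m_k+j}\Gamma_k^{(j)}$ and $\bar r_k$ by $\bar r_k-q_{k-m_k+j}\Gamma_k^{(j)}$. (4) $x_{k+1}:=\bar x_k+\beta_k\bar r_k$, $m_{k+1}:=m_k+1$ (possibly reset to $0$ in iteration $k+1$). In statements, $m_k$ denotes the final value in iteration $k$ (after possible resets). Convention. "If $x_0$ is sufficiently close to $x^*$, then ... $\hat\kappa\,\mathcal{O}(t)$" means: there are $\varepsilon>0$ and $C>0$, depending on $g$, $x^*$, the fixed constants and the method parameters ($m,\tau,\eta,\theta$) but not on $x_0$ or $k$, such that whenever $\|x_0-x^*\|_2\le\varepsilon$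 the assertion holds with $\hat\kappa\,\mathcal{O}(t)$ standing for a quantity bounded in absolute value by $\hat\kappa Ct$. *)

theory Defs
  imports "HOL-Analysis.Analysis"
begin

definition sym_part :: "real^'n^'n \<Rightarrow> real^'n^'n" where
  "sym_part B = (1/2) *\<^sub>R (B + transpose B)"

text \<open>Real eigenvalues suffice: the matrix is symmetric, so it has no others.\<close>

definition is_eigenvalue :: "real^'n^'n \<Rightarrow> real \<Rightarrow> bool" where
  "is_eigenvalue B l \<longleftrightarrow> (\<exists>v. v \<noteq> 0 \<and> B *v v = l *\<^sub>R v)"

definition positive_definite :: "real^'n^'n \<Rightarrow> bool" where
  "positive_definite B \<longleftrightarrow> (\<forall>l. is_eigenvalue (sym_part B) l \<longrightarrow> l > 0)"

definition energy_norm :: "real^'n^'n \<Rightarrow> real^'n \<Rightarrow> real" where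
  "energy_norm A x = sqrt (x \<bullet> (A *v x))"

definition spectral_norm :: "real^'n^'n \<Rightarrow> real" where
  "spectral_norm B = onorm (\<lambda>y. B *v y)"

text \<open>The set \<open>U\<close> is the neighbourhood on which \<open>h\<close> is Lipschitz continuously differentiable.
  The Lipschitz condition uses the library (Frobenius) norm on matrices, which is
  equivalent to any other one.\<close>

definition assumption_H ::
  "(real^'n \<Rightarrow> real^'n) \<Rightarrow> real^'n \<Rightarrow> (real^'n) set \<Rightarrow> bool" where
  "assumption_H h xs U \<longleftrightarrow>
     h xs = 0 \<and>
     open U \<and> xs \<in> U \<and>
     (\<forall>x\<in>U. h differentiable (at x)) \<and>
     (\<exists>K. K-lipschitz_on U (\<lambda>x. jacobian h (at x))) \<and>
     positive_definite (jacobian h (at xs))"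

text \<open>Differentiability on the ball is stated explicitly because \<^const>\<open>jacobian\<close> is an
  unspecified matrix at points where \<open>h\<close> is not differentiable.\<close>

definition local_constants ::
  "(real^'n \<Rightarrow> real^'n) \<Rightarrow> real^'n \<Rightarrow> real \<Rightarrow> real \<Rightarrow> real \<Rightarrow> real \<Rightarrow> bool" where
  "local_constants h xs \<rho> \<kappa> \<mu> L \<longleftrightarrow>
     0 < \<rho> \<and> 0 < \<kappa> \<and> 0 < \<mu> \<and> 0 < L \<and>
     (\<forall>x\<in>cball xs \<rho>.
        h differentiable (at x) \<and>
        (\<forall>y. \<mu> * norm y \<le> norm (jacobian h (at x) *v y) \<and>
             norm (jacobian h (at x) *v y) \<le> L * norm y \<and>
             \<mu> * (norm y)\<^sup>2 \<le> y \<bullet> (jacobian h (at x) *v y) \<and>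
             y \<bullet> (jacobian h (at x) *v y) \<le> L * (norm y)\<^sup>2) \<and>
        norm (h x - jacobian h (at xs) *v (x - xs)) \<le> 1/2 * \<kappa> * (norm (x - xs))\<^sup>2)"

definition residual :: "(real^'n \<Rightarrow> real^'n) \<Rightarrow> real^'n \<Rightarrow> real^'n" where
  "residual g x = g x - x"

datatype am_type = Type_I | Type_II

definition v_vec :: "am_type \<Rightarrow> 'a \<Rightarrow> 'a \<Rightarrow> 'a" where
  "v_vec ty p q = (case ty of Type_I \<Rightarrow> p | Type_II \<Rightarrow> q)"

text \<open>One loop pass with the stored direction \<open>(pj, qj)\<close> acting on the pair \<open>(a, b)\<close>; it serves
  both for the orthogonalisation of \<open>(p\<^sub>k, q\<^sub>k)\<close>, with coefficient \<open>\<zeta>\<close>, and for the projection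
  of \<open>(x\<^sub>k, r\<^sub>k)\<close>, with coefficient \<open>\<Gamma>\<close>.\<close>

definition reduce_pair ::
  "am_type \<Rightarrow> real^'n \<Rightarrow> real^'n \<Rightarrow> (real^'n) \<times> (real^'n) \<Rightarrow> (real^'n) \<times> (real^'n)" where
  "reduce_pair ty pj qj = (\<lambda>(a, b).
     let c = (v_vec ty pj qj \<bullet> b) / (v_vec ty pj qj \<bullet> qj)
     in (a - c *\<^sub>R pj, b - c *\<^sub>R qj))"

text \<open>Iteration \<open>k\<close> of the restarted method. The sequence \<open>M\<close> holds the final values of
  \<open>m\<^sub>k\<close>; \<open>m0\<close> and \<open>m1\<close> are the values before and after the first restart test.
  The vectors \<open>p k\<close> and \<open>q k\<close> are unconstrained if the first test restarts; they are
  never used in that case. Truncated subtraction is harmless in the loop bounds because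
  of the maximum with 1.\<close>

definition st_am_iteration ::
  "am_type \<Rightarrow> (real^'n \<Rightarrow> real^'n) \<Rightarrow> nat \<Rightarrow> real \<Rightarrow> real \<Rightarrow> (nat \<Rightarrow> real) \<Rightarrow>
   (nat \<Rightarrow> real^'n) \<Rightarrow> (nat \<Rightarrow> real^'n) \<Rightarrow> (nat \<Rightarrow> real^'n) \<Rightarrow> (nat \<Rightarrow> nat) \<Rightarrow> nat \<Rightarrow> bool" where
  "st_am_iteration ty g m \<tau> \<eta> \<beta> x p q M k \<longleftrightarrow>
    (let r = (\<lambda>j. residual g (x j));
         v = (\<lambda>j. v_vec ty (p j) (q j));
         m0 = (if k = 0 then 0 else M (k - 1) + 1);
         m1 = (if m0 > m \<or> norm (r k) > \<eta> * norm (r (k - m0)) then 0 else m0)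
     in (m1 > 0 \<longrightarrow>
           (p k, q k) =
             fold (\<lambda>j. reduce_pair ty (p (k - m1 + j)) (q (k - m1 + j)))
                  [max 1 (m1 - 2)..<m1] (x k - x (k - 1), r k - r (k - 1))) \<and>
        M k = (if m1 > 0 \<and> \<bar>v k \<bullet> q k\<bar> < \<tau> * \<bar>v (k - m1 + 1) \<bullet> q (k - m1 + 1)\<bar>
               then 0 else m1) \<and>
        (let (xbar, rbar) =
               fold (\<lambda>j. reduce_pair ty (p (k - M k + j)) (q (k - M k + j)))
                    [max 1 (M k - 1)..<M k + 1] (x k, r k)
         in x (k + 1) = xbar + \<beta> k *\<^sub>R rbar))"

text \<open>The method stops at the first vanishing residual, so iteration \<open>k\<close> is carried out
  exactly if the residuals up to \<open>k\<close> are nonzero.\<close>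

definition performed :: "(real^'n \<Rightarrow> real^'n) \<Rightarrow> (nat \<Rightarrow> real^'n) \<Rightarrow> nat \<Rightarrow> bool" where
  "performed g x k \<longleftrightarrow> (\<forall>j\<le>k. residual g (x j) \<noteq> 0)"

definition st_am_run ::
  "am_type \<Rightarrow> (real^'n \<Rightarrow> real^'n) \<Rightarrow> nat \<Rightarrow> real \<Rightarrow> real \<Rightarrow> (nat \<Rightarrow> real) \<Rightarrow>
   (nat \<Rightarrow> real^'n) \<Rightarrow> (nat \<Rightarrow> real^'n) \<Rightarrow> (nat \<Rightarrow> real^'n) \<Rightarrow> (nat \<Rightarrow> nat) \<Rightarrow> bool" where
  "st_am_run ty g m \<tau> \<eta> \<beta> x p q M \<longleftrightarrow>
     (\<forall>k. performed g x k \<longrightarrow> st_am_iteration ty g m \<tau> \<eta> \<beta> x p q M k)"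

end

theory Submission
  imports Defs "HOL-Library.Landau_Symbols"
begin

text \<open>
  Restarts cut a run into cycles. In a cycle that starts at $x_s$ with error $e_0 = x_s - x^*$, the
  residual of an iterate $x$ equals $-A (x - x^*)$ up to $O(|e_0|^2)$. So the cycle is a perturbation
  of the one that the method would perform, from the same start and with the same mixing parameters,
  for the linear residual. The proof analyses the linear cycle exactly, bounds the perturbation by
  $O(|e_0|^2)$, and then follows the cycles of a run.

  \<^bold>\<open>The linear cycle.\<close> There $q = -A p$ and $r = -A e$ always, and all coefficients are quotients
  $\langle p, e\rangle / \langle p, p\rangle$ for the inner product given by $A$ (Type I) or by $A^2$ (Type II).
  So both types are one algorithm in an inner product for which $A$ is self-adjoint.
  As for the Lanczos process, orthogonalising against the last two directions then makes a direction
  orthogonal to all earlier ones, and the directions span the Krylov space of $A e_0$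
  (\<open>cycle_invariants\<close>). Hence the projected error is the shortest vector in $e_0$ plus that space,
  and it is no longer than $f(A) e_0$ for any polynomial $f$ of degree at most the number of directions
  with $f(0) = 1$; the rescaled Chebyshev polynomial gives the convergence factor
  (\<open>chebyshev_bound\<close>). If the directions span the whole space, the projected error vanishes
  (\<open>full_cycle_exact\<close>). The final mixing step applies $I - \beta A$, whose norm in either inner
  product is at most its spectral norm (\<open>mixing_contraction\<close>).

  Diagonalising $A$ is avoided. The bound on Chebyshev polynomials of a self-adjoint contraction
  comes from the Pell identity $T_n^2 + (1 - X^2) U_{n-1}^2 = 1$ (\<open>cheb_contraction\<close>), and
  contractivity in the energy inner products from $(X + Y) X Y = X Y X + Y X Y$ for commuting $X$, $Y$
  (\<open>product_nonneg\<close>).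

  \<^bold>\<open>The perturbation.\<close> All vectors of a cycle are $O(|e_0|)$, and the linear ones differ from the
  actual ones by $O(|e_0|^2)$. This survives each step if the denominators $v^T q$ are bounded below
  by a multiple of $|e_0|^2$ (\<open>tracks_reduce_pair\<close>). The first one is, because $p_1 = \beta r$ has
  length of order $|e_0|$; the others are, by the restart test with $\tau$ (\<open>tracks_cycle\<close>).

  \<^bold>\<open>The run.\<close> A cycle multiplies the norm of the error in the inner product above by at most
  $\theta < 1$, up to $O(|e_0|^2)$. Near $x^*$ it therefore never increases this norm,
  so every cycle of the run starts close enough to $x^*$ for the same constants to apply (\<open>st_am_run_cycle_bounds\<close>).
\<close>

section \<open>Conjugate directions for a self-adjoint operator\<close>

text \<open>
  One projection step. For $p = 0$ the quotient is $0/0 = 0$ and the step does nothing; this is what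
  allows the start of a cycle to be treated with fictitious zero directions.
\<close>

definition ip_reduce :: "('a::real_vector \<Rightarrow> 'a \<Rightarrow> real) \<Rightarrow> 'a \<Rightarrow> 'a \<Rightarrow> 'a" where
  "ip_reduce ip p u = u - (ip p u / ip p p) *\<^sub>R p"

locale selfadjoint_form =
  fixes ip :: "'a::real_vector \<Rightarrow> 'a \<Rightarrow> real" and A :: "'a \<Rightarrow> 'a"
  assumes bilinear: "bilinear ip"
    and commute: "ip u w = ip w u"
    and pos: "u \<noteq> 0 \<Longrightarrow> 0 < ip u u"
    and linear: "linear A"
    and adjoint: "ip (A u) w = ip u (A w)"
begin

lemmas ip_simps = bilinear_ladd[OF bilinear] bilinear_radd[OF bilinear]
  bilinear_lsub[OF bilinear] bilinear_rsub[OF bilinear]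
  bilinear_lmul[OF bilinear] bilinear_rmul[OF bilinear]
  bilinear_lzero[OF bilinear] bilinear_rzero[OF bilinear]
  bilinear_lneg[OF bilinear] bilinear_rneg[OF bilinear]

lemmas A_simps = linear_add[OF linear] linear_diff[OF linear] linear_scale[OF linear]
  linear_0[OF linear] linear_neg[OF linear]

lemma nonneg: "0 \<le> ip u u"
  using pos[of u] by (cases "u = 0") (auto simp: ip_simps)

lemma eq_0_iff: "ip u u = 0 \<longleftrightarrow> u = 0"
  using pos[of u] by (cases "u = 0") (auto simp: ip_simps)

lemma orthogonal_span:
  assumes "u \<in> span X" and "\<And>x. x \<in> X \<Longrightarrow> ip x w = 0"
  shows "ip u w = 0"
  using assms(1)
  by (induction rule: span_induct_alt) (auto simp: ip_simps assms(2))

lemma reduce_0 [simp]: "ip_reduce ip 0 u = u"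
  by (simp add: ip_reduce_def)

lemma reduce_reduce_orthogonal:
  assumes "ip a b = 0"
  shows "ip a (ip_reduce ip b (ip_reduce ip a u)) = 0"
    and "ip b (ip_reduce ip b (ip_reduce ip a u)) = 0"
proof -
  have *: "ip a (ip_reduce ip a w) = 0" for a w
    by (cases "a = 0") (auto simp: ip_reduce_def ip_simps eq_0_iff)
  show "ip b (ip_reduce ip b (ip_reduce ip a u)) = 0" by (rule *)
  show "ip a (ip_reduce ip b (ip_reduce ip a u)) = 0"
    using assms *[of a u] by (simp add: ip_reduce_def ip_simps)
qed

lemma orthogonal_reduce:
  assumes "ip c a = 0" "ip c b = 0" "ip c u = 0"
  shows "ip c (ip_reduce ip b (ip_reduce ip a u)) = 0"
  using assms by (simp add: ip_reduce_def ip_simps)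

lemma reduce_diff_span: "u - ip_reduce ip b (ip_reduce ip a u) \<in> span {a, b}"
proof -
  have "a \<in> span {a,b}" "b \<in> span {a,b}" by (auto intro: span_base)
  then show ?thesis
    unfolding ip_reduce_def by (auto intro!: span_add span_diff span_scale)
qed

end

text \<open>
  A cycle for the linear residual, written in terms of the errors \<open>e\<close> and the directions \<open>P\<close> alone.
  The same two directions serve to project \<open>e i\<close> and to orthogonalise the next increment. With
  \<open>P 0 = 0\<close> and truncated subtraction, the recursion is uniform in \<open>i\<close>.
\<close>

locale linear_cycle = selfadjoint_form ip A
  for ip :: "'a::real_vector \<Rightarrow> 'a \<Rightarrow> real" and A +
  fixes \<beta> :: "nat \<Rightarrow> real" and e P ebar :: "nat \<Rightarrow> 'a"
  assumes P_0: "P 0 = 0"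
    and ebar: "ebar i = ip_reduce ip (P i) (ip_reduce ip (P (i - 1)) (e i))"
    and e_Suc: "e (Suc i) = ebar i - \<beta> i *\<^sub>R A (ebar i)"
    and P_Suc: "P (Suc i) = ip_reduce ip (P i) (ip_reduce ip (P (i - 1)) (e (Suc i) - e i))"
begin

definition V :: "nat \<Rightarrow> 'a set" where
  "V n = span (P ` {..n})"

lemma P_in_V: "i \<le> n \<Longrightarrow> P i \<in> V n"
  unfolding V_def by (intro span_base) auto

lemma V_mono: "i \<le> n \<Longrightarrow> V i \<subseteq> V n"
  unfolding V_def by (intro span_mono) auto

lemma V_0: "V 0 = {0}"
  by (auto simp: V_def P_0)

lemma V_add: "u \<in> V n \<Longrightarrow> w \<in> V n \<Longrightarrow> u + w \<in> V n"
  and V_diff: "u \<in> V n \<Longrightarrow> w \<in> V n \<Longrightarrow> u - w \<in> V n"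
  and V_scale: "u \<in> V n \<Longrightarrow> c *\<^sub>R u \<in> V n"
  and V_neg: "u \<in> V n \<Longrightarrow> - u \<in> V n"
  unfolding V_def by (auto intro: span_add span_diff span_scale span_neg)

lemma V_Suc: "u \<in> V n \<Longrightarrow> u \<in> V (Suc n)"
  using V_mono[of n "Suc n"] by auto

lemma span_pair_V: "span {P (n - 1), P n} \<subseteq> V n"
  unfolding V_def by (intro span_mono) auto

lemma P_1: "P (Suc 0) = - (\<beta> 0 *\<^sub>R A (e 0))"
  by (simp add: P_Suc P_0 e_Suc ebar)

lemma P_Suc_diff: "e (Suc n) - e n - P (Suc n) \<in> V n"
  using span_pair_V[of n] reduce_diff_span P_Suc[of n] by auto

lemma ebar_diff_e: "e n - ebar n \<in> V n"
  using span_pair_V[of n] reduce_diff_span ebar[of n] by auto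

lemma e_diff: "e n - e 0 \<in> V n"
proof (induction n)
  case 0 show ?case by (simp add: V_def span_0)
next
  case (Suc n)
  have "e (Suc n) - e 0 = (e (Suc n) - e n - P (Suc n)) + P (Suc n) + (e n - e 0)" by simp
  also have "\<dots> \<in> V (Suc n)"
    by (rule V_add[OF V_add[OF V_Suc[OF P_Suc_diff] P_in_V] V_Suc[OF Suc]]) simp
  finally show ?case .
qed

lemma ebar_diff: "ebar n - e 0 \<in> V n"
proof -
  have "ebar n - e 0 = (e n - e 0) - (e n - ebar n)" by simp
  also have "\<dots> \<in> V n"
    by (rule V_diff[OF e_diff ebar_diff_e])
  finally show ?thesis .
qed

lemma V_Suc_decompose:
  assumes "w \<in> V (Suc n)" obtains c w' where "w = c *\<^sub>R P (Suc n) + w'" "w' \<in> V n"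
proof -
  have "w \<in> span (insert (P (Suc n)) (P ` {..n}))"
    using assms unfolding V_def by (simp add: atMost_Suc)
  then obtain c where "w - c *\<^sub>R P (Suc n) \<in> span (P ` {..n})"
    by (auto simp: span_insert)
  then show thesis using that[of c "w - c *\<^sub>R P (Suc n)"] by (simp add: V_def)
qed

lemma A_V:
  assumes "\<And>i. i \<le> n \<Longrightarrow> A (P i) \<in> V m" and "w \<in> V n"
  shows "A w \<in> V m"
proof -
  have "A w \<in> span (A ` P ` {..n})"
    using assms(2) linear_span_image[OF linear] unfolding V_def by blast
  also have "\<dots> \<subseteq> V m"
    using assms(1) unfolding V_def by (intro span_minimal) auto
  finally show ?thesis .
qed

lemma A_e0_in_V:
  assumes "\<beta> 0 \<noteq> 0" "1 \<le> n" shows "A (e 0) \<in> V n"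
proof -
  have "A (e 0) = (- 1 / \<beta> 0) *\<^sub>R P (Suc 0)"
    using assms by (simp add: P_1)
  then show ?thesis using P_in_V[of "Suc 0" n] assms unfolding V_def by (auto intro: span_scale span_neg)
qed

text \<open>
  The three invariants must be proved together. Self-adjointness moves $A$ from the projected error to
  an old direction, and $A$ maps an old direction into the span of the directions up to the next one,
  to which the projected error is orthogonal; so only the last two directions need an explicit
  orthogonalisation. In turn, a new direction that differs from zero and is orthogonal to the
  previous span must contain a nonzero multiple of $A$ applied to the last direction, which gives the
  second invariant.
\<close>

lemma cycle_invariants:
  assumes "\<And>i. \<beta> i \<noteq> 0" and "\<And>i. 1 \<le> i \<Longrightarrow> i \<le> n \<Longrightarrow> P i \<noteq> 0"
  shows "(\<forall>j\<le>n. \<forall>i<j. ip (P i) (P j) = 0) \<and>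
         (\<forall>i<n. A (P i) \<in> V (Suc i)) \<and>
         (\<forall>i\<le>n. ip (P i) (ebar n) = 0)"
  using assms(2)
proof (induction n)
  case 0
  then show ?case by (simp add: P_0 ip_simps)
next
  case (Suc n)
  have I1: "\<And>i j. j \<le> n \<Longrightarrow> i < j \<Longrightarrow> ip (P i) (P j) = 0"
    and I2: "\<And>i. i < n \<Longrightarrow> A (P i) \<in> V (Suc i)"
    and I3: "\<And>i. i \<le> n \<Longrightarrow> ip (P i) (ebar n) = 0"
    using Suc by auto
  have consecutive: "ip (P (n - 1)) (P n) = 0"
    using I1[of n "n-1"] by (cases n) (auto simp: P_0 ip_simps)
  have V_ebar: "ip w (ebar n) = 0" if "w \<in> V n" for w
    by (rule orthogonal_span[of w "P ` {..n}"]) (use that I3 in \<open>auto simp: V_def\<close>)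
  have A_ebar: "ip (P i) (A (ebar n)) = 0" if "i < n" for i
    using V_ebar[of "A (P i)"] I2[OF that] V_mono[of "Suc i" n] that
    by (auto simp flip: adjoint)
  have P_new: "ip (P i) (P (Suc n)) = 0" if "i \<le> n" for i
  proof -
    have "i = n \<or> i = n - 1 \<or> i < n - 1" using that by linarith
    then consider "i = n" | "i = n - 1" | "i < n - 1" by blast
    then show ?thesis
    proof cases
      case 3
      then have "ip (P i) (P n) = 0" "ip (P i) (P (n - 1)) = 0" using I1 by auto
      moreover have "ip (P i) (e (Suc n) - e n) = 0"
      proof -
        have "e n - ebar n \<in> span {P (n-1), P n}"
          using reduce_diff_span ebar[of n] by auto
        then have "ip (e n - ebar n) (P i) = 0"
          by (rule orthogonal_span) (use calculation in \<open>auto simp: commute\<close>)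
        then have "ip (P i) (e n - ebar n) = 0" by (simp add: commute)
        moreover have "e (Suc n) - e n = - (e n - ebar n) - \<beta> n *\<^sub>R A (ebar n)"
          by (simp add: e_Suc)
        ultimately show ?thesis using A_ebar[of i] 3 by (simp add: ip_simps)
      qed
      ultimately show ?thesis unfolding P_Suc by (intro orthogonal_reduce)
    qed (use reduce_reduce_orthogonal[OF consecutive] P_Suc in auto)
  qed
  have "A (P n) \<in> V (Suc n)"
  proof (cases n)
    case 0 then show ?thesis by (simp add: P_0 A_simps V_def span_0)
  next
    case n: (Suc n')
    obtain c w' where w: "ebar n - e 0 = c *\<^sub>R P n + w'" "w' \<in> V n'"
      using V_Suc_decompose ebar_diff[of n] n by metis
    have Aw': "A w' \<in> V n"
    proof (rule A_V[OF _ w(2)])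
      fix i assume "i \<le> n'"
      then show "A (P i) \<in> V n" using I2[of i] V_mono[of "Suc i" n] n by auto
    qed
    have Ae0: "A (e 0) \<in> V n" using A_e0_in_V n assms(1) by auto
    define z where "z = - (e (Suc n) - e n - P (Suc n)) - (e n - ebar n) - \<beta> n *\<^sub>R (A (e 0) + A w')"
    have z: "z \<in> V n"
      unfolding z_def
      by (rule V_diff[OF V_diff[OF V_neg[OF P_Suc_diff] ebar_diff_e] V_scale[OF V_add[OF Ae0 Aw']]])
    have "ebar n = e 0 + (c *\<^sub>R P n + w')" using w(1) by (simp add: algebra_simps)
    then have "A (ebar n) = A (e 0) + c *\<^sub>R A (P n) + A w'" by (simp add: A_simps)
    then have Pz: "P (Suc n) = z - (\<beta> n * c) *\<^sub>R A (P n)"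
      by (simp add: z_def e_Suc scaleR_add_right)
    \<comment> \<open>If \<open>c = 0\<close>, the new direction lies in the old span and is orthogonal to it.\<close>
    have "c \<noteq> 0"
    proof
      assume "c = 0"
      then have "P (Suc n) \<in> V n" using Pz z by simp
      then have "ip (P (Suc n)) (P (Suc n)) = 0"
        unfolding V_def by (rule orthogonal_span) (use P_new in auto)
      then show False using Suc.prems[of "Suc n"] by (simp add: eq_0_iff)
    qed
    then have "A (P n) = (1 / (\<beta> n * c)) *\<^sub>R (z - P (Suc n))"
      using Pz assms(1)[of n] by simp
    moreover have "\<dots> \<in> V (Suc n)"
      by (rule V_scale[OF V_diff[OF V_Suc[OF z] P_in_V]]) simp
    ultimately show ?thesis by simp
  qed
  moreover have "ip (P i) (ebar (Suc n)) = 0" if "i \<le> Suc n" for i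
  proof -
    have c: "ip (P n) (P (Suc n)) = 0" using P_new by simp
    have "i = n \<or> i = Suc n \<or> i < n" using that by linarith
    then consider "i = n" | "i = Suc n" | "i < n" by blast
    then show ?thesis
    proof cases
      case 3
      then have "ip (P i) (e (Suc n)) = 0"
        using I3[of i] A_ebar[of i] by (simp add: e_Suc ip_simps)
      moreover have "ip (P i) (P n) = 0" "ip (P i) (P (Suc n)) = 0"
        using 3 I1 P_new by auto
      ultimately show ?thesis unfolding ebar[of "Suc n"] by (intro orthogonal_reduce) auto
    qed (use reduce_reduce_orthogonal[OF c] ebar[of "Suc n"] in auto)
  qed
  ultimately show ?case using I1 I2 P_new by (auto simp: less_Suc_eq le_Suc_eq)
qed

text \<open>
  By Pythagoras, because the difference of two competitors is orthogonal to the projected error.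
\<close>

lemma ebar_minimal:
  assumes "\<And>i. \<beta> i \<noteq> 0" and "\<And>i. 1 \<le> i \<Longrightarrow> i \<le> n \<Longrightarrow> P i \<noteq> 0"
    and "y - e 0 \<in> V n"
  shows "ip (ebar n) (ebar n) \<le> ip y y"
proof -
  define w where "w = y - ebar n"
  have "w = (y - e 0) - (ebar n - e 0)" by (simp add: w_def)
  also have "\<dots> \<in> V n" by (rule V_diff[OF assms(3) ebar_diff])
  finally have "ip w (ebar n) = 0"
    unfolding V_def
    by (rule orthogonal_span) (use cycle_invariants[of n] assms in auto)
  moreover have "y = ebar n + w" by (simp add: w_def)
  ultimately have "ip y y = ip (ebar n) (ebar n) + ip w w"
    by (simp add: ip_simps commute)
  then show ?thesis using nonneg[of w] by simp
qed

end

context selfadjoint_form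
begin

lemma cauchy_schwarz: "(ip u w)\<^sup>2 \<le> ip u u * ip w w"
proof (cases "w = 0")
  case True then show ?thesis by (simp add: ip_simps)
next
  case False
  then have w: "ip w w > 0" by (rule pos)
  have "0 \<le> ip (ip_reduce ip w u) (ip_reduce ip w u)" by (rule nonneg)
  also have "\<dots> = ip u u - (ip u w)\<^sup>2 / ip w w"
    using w by (simp add: ip_reduce_def ip_simps commute[of w u] power2_eq_square field_simps)
  finally show ?thesis using w by (simp add: field_simps)
qed

lemma triangle: "sqrt (ip (u + w) (u + w)) \<le> sqrt (ip u u) + sqrt (ip w w)"
proof (rule real_le_lsqrt)
  have "\<bar>ip u w\<bar> \<le> sqrt (ip u u * ip w w)"
    using cauchy_schwarz[of u w] by (intro real_le_rsqrt) simp
  then show "ip (u + w) (u + w) \<le> (sqrt (ip u u) + sqrt (ip w w))\<^sup>2"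
    using nonneg by (simp add: power2_sum ip_simps commute[of w u] real_sqrt_mult)
qed (simp_all add: nonneg)

end

section \<open>Chebyshev polynomials of a self-adjoint contraction\<close>

text \<open>
  The pair $(T_n(B) u, U_{n-1}(B) u)$ of Chebyshev polynomials of both kinds. This recursion is the
  addition theorem for $\cos(n+1)t$ and $\sin(n+1)t / \sin t$ with $B = \cos t$; in contrast to the
  three-term recursion it keeps the Pell identity as an invariant.
\<close>

fun cheb :: "('a \<Rightarrow> 'a) \<Rightarrow> 'a \<Rightarrow> nat \<Rightarrow> ('a::real_vector) \<times> 'a" where
  "cheb B u 0 = (u, 0)"
| "cheb B u (Suc n) = (let (t, s) = cheb B u n in (B t - (s - B (B s)), B s + t))"

context selfadjoint_form
begin

text \<open>
  With $(t, s) = (T_n(B) u, U_{n-1}(B) u)$, the Pell identity reads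
  $\langle t, t\rangle + \langle s, s\rangle - \langle B s, B s\rangle = \langle u, u\rangle$. The contribution of $s$ is nonnegative
  because $B$ is a contraction.
\<close>

lemma cheb_contraction:
  assumes "linear B" and adj: "\<And>u w. ip (B u) w = ip u (B w)"
    and contr: "\<And>w. ip (B w) (B w) \<le> ip w w"
  shows "ip (fst (cheb B u n)) (fst (cheb B u n)) \<le> ip u u"
proof -
  note B_simps = linear_add[OF \<open>linear B\<close>] linear_diff[OF \<open>linear B\<close>]
  have inv: "ip t t + ip s s - ip (B s) (B s) = ip u u" if "cheb B u n = (t, s)" for t s n
    using that
  proof (induction n arbitrary: t s)
    case 0 then show ?case by (auto simp: ip_simps linear_0[OF \<open>linear B\<close>])
  next
    case (Suc n)
    obtain t0 s0 where ts: "cheb B u n = (t0, s0)" by fastforce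
    have t: "t = B t0 - (s0 - B (B s0))" and s: "s = B s0 + t0" using Suc.prems ts by auto
    have comm: "ip (B (B s0)) t0 = ip (B s0) (B t0)" by (simp add: adj)
    have comm2: "ip (B (B s0)) s0 = ip (B s0) (B s0)" by (simp add: adj)
    have comm3: "ip (B (B s0)) (B t0) = ip (B t0) (B (B s0))" "ip s0 (B t0) = ip (B t0) s0"
        "ip s0 (B (B s0)) = ip (B (B s0)) s0" "ip (B s0) (B t0) = ip (B t0) (B s0)"
        "ip t0 (B s0) = ip (B s0) t0" by (simp_all only: commute)
    have "ip (B t0) s0 = ip (B s0) t0" using adj[of s0 t0] by (simp add: commute)
    then have "ip t t + ip s s - ip (B s) (B s) = ip t0 t0 + ip s0 s0 - ip (B s0) (B s0)"
      unfolding t s using comm comm2 comm3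
      by (simp add: ip_simps B_simps algebra_simps)
    then show ?case using Suc.IH[OF ts] by simp
  qed
  obtain t s where ts: "cheb B u n = (t, s)" by fastforce
  show ?thesis using inv[OF ts] contr[of s] ts by simp
qed

end

text \<open>
  The value outside $[-1, 1]$, where it grows like $z^n / 2$.
\<close>

lemma cheb_scalar:
  fixes z :: real
  assumes "z > 1"
  shows "cheb (\<lambda>x. (z + 1/z)/2 * x) 1 n = ((z^n + 1/z^n)/2, (z^n - 1/z^n)/(z - 1/z))"
proof (induction n)
  case 0 then show ?case by simp
next
  case (Suc n)
  define w where "w = 1/z"
  have zw: "z * w = 1" using assms by (simp add: w_def)
  have ne: "z - w \<noteq> 0" using assms by (auto simp: w_def field_simps) (smt (verit) mult_less_cancel_right1)
  have pw: "1/z^k = w^k" for k by (simp add: w_def power_divide)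
  define a b where "a = z^n" and "b = w^n"
  have E: "(z - w) * ((z - w)/4) = ((z+w)/2)*((z+w)/2) - 1" using zw by (simp add: algebra_simps) argo
  have D: "(a - b)/(z - w) - (z+w)/2 * ((z+w)/2 * ((a-b)/(z-w))) = - ((a-b) * ((z - w)/4))"
  proof -
    have "y - x * (x * y) = - ((x * x - 1) * y)" for x y :: real
      by (simp add: algebra_simps)
    then have "(a - b)/(z - w) - (z+w)/2 * ((z+w)/2 * ((a-b)/(z-w))) = - ((((z+w)/2)*((z+w)/2) - 1) * ((a-b)/(z-w)))" .
    also have "\<dots> = - ((a-b) * ((z - w)/4))" unfolding E[symmetric] using ne by (simp add: field_simps)
    finally show ?thesis .
  qed
  have "(z+w)/2 * ((a+b)/2) - ((a - b)/(z - w) - (z+w)/2 * ((z+w)/2 * ((a-b)/(z-w)))) = (z*a + w*b)/2"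
    unfolding D by (simp add: field_simps)
  moreover have "(z+w)/2 * ((a-b)/(z-w)) + (a+b)/2 = (z*a - w*b)/(z-w)"
    using ne by (simp add: field_simps)
  moreover have "cheb (\<lambda>x. (z + w)/2 * x) 1 n = ((a+b)/2, (a-b)/(z-w))"
    using Suc unfolding a_def b_def by (simp add: pw flip: w_def)
  ultimately have "cheb (\<lambda>x. (z + w)/2 * x) 1 (Suc n) = ((z*a + w*b)/2, (z*a - w*b)/(z-w))"
    by (simp only: cheb.simps(2) Let_def prod.case)
  then show ?case unfolding pw a_def b_def w_def[symmetric] by simp
qed

context linear_cycle
begin

lemma A_e0_plus_V:
  assumes "\<And>i. \<beta> i \<noteq> 0" and "\<And>i. 1 \<le> i \<Longrightarrow> i \<le> n \<Longrightarrow> P i \<noteq> 0"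
    and "i < n" and "y - c *\<^sub>R e 0 \<in> V i"
  shows "A y \<in> V (Suc i)"
proof -
  have "A (y - c *\<^sub>R e 0) \<in> V (Suc i)"
  proof (rule A_V[OF _ assms(4)])
    fix j assume "j \<le> i"
    then have "A (P j) \<in> V (Suc j)" using cycle_invariants[of n] assms by auto
    then show "A (P j) \<in> V (Suc i)" using V_mono[of "Suc j" "Suc i"] \<open>j \<le> i\<close> by auto
  qed
  moreover have "A (e 0) \<in> V (Suc i)" using A_e0_in_V assms(1) by simp
  moreover have "A y = A (y - c *\<^sub>R e 0) + c *\<^sub>R A (e 0)" by (simp add: A_simps)
  ultimately show ?thesis by (auto intro: V_add V_scale)
qed

text \<open>
  $T_k(B) e_0$ is a multiple of $e_0$ plus a vector of the Krylov space, and the multiple is the value of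
  $T_k$ at the image $a$ of $0$ under the affine map that turns $A$ into $B$.
\<close>

lemma cheb_in_V:
  fixes a r :: real
  defines "B \<equiv> \<lambda>x. a *\<^sub>R x - r *\<^sub>R A x"
  assumes "\<And>i. \<beta> i \<noteq> 0" and "\<And>i. 1 \<le> i \<Longrightarrow> i \<le> n \<Longrightarrow> P i \<noteq> 0"
    and "k \<le> n"
  shows "fst (cheb B (e 0) k) - fst (cheb (\<lambda>x. a * x) 1 k) *\<^sub>R e 0 \<in> V k"
proof -
  have B_step: "B y - (a * c) *\<^sub>R e 0 \<in> V (Suc i)" if "i < n" "y - c *\<^sub>R e 0 \<in> V i" for y c i
  proof -
    have "B y - (a * c) *\<^sub>R e 0 = a *\<^sub>R (y - c *\<^sub>R e 0) - r *\<^sub>R A y"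
      by (simp add: B_def algebra_simps)
    moreover have "A y \<in> V (Suc i)"
      by (rule A_e0_plus_V[of n]) (use assms that in auto)
    ultimately show ?thesis
      using V_diff[OF V_scale[OF V_Suc[OF that(2)]] V_scale, of "A y"] by simp
  qed
  have "t - c *\<^sub>R e 0 \<in> V k \<and> s - d *\<^sub>R e 0 \<in> V k \<and> B s - (a * d) *\<^sub>R e 0 \<in> V k"
    if "cheb B (e 0) k = (t, s)" "cheb (\<lambda>x. a * x) 1 k = (c, d)" "k \<le> n" for t s c d k
    using that
  proof (induction k arbitrary: t s c d)
    case 0
    then show ?case by (auto simp: B_def A_simps V_def span_0)
  next
    case (Suc k)
    obtain t0 s0 where ts: "cheb B (e 0) k = (t0, s0)" by fastforce
    obtain c0 d0 where cd: "cheb (\<lambda>x. a * x) 1 k = (c0, d0)" by fastforce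
    have t: "t = B t0 - (s0 - B (B s0))" and s: "s = B s0 + t0"
      and c: "c = a * c0 - (d0 - a * (a * d0))" and d: "d = a * d0 + c0"
      using Suc.prems ts cd by auto
    have k: "k < n" using Suc.prems by simp
    have IH: "t0 - c0 *\<^sub>R e 0 \<in> V k" "s0 - d0 *\<^sub>R e 0 \<in> V k" "B s0 - (a * d0) *\<^sub>R e 0 \<in> V k"
      using Suc.IH[OF ts cd] k by auto
    have "s - d *\<^sub>R e 0 = (B s0 - (a * d0) *\<^sub>R e 0) + (t0 - c0 *\<^sub>R e 0)"
      by (simp add: s d algebra_simps)
    then have sd: "s - d *\<^sub>R e 0 \<in> V k" using V_add[OF IH(3) IH(1)] by simp
    have "t - c *\<^sub>R e 0 = (B t0 - (a * c0) *\<^sub>R e 0) - (s0 - d0 *\<^sub>R e 0)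
        + (B (B s0) - (a * (a * d0)) *\<^sub>R e 0)"
      by (simp add: t c algebra_simps)
    then have "t - c *\<^sub>R e 0 \<in> V (Suc k)"
      using V_add[OF V_diff[OF B_step[OF k IH(1)] V_Suc[OF IH(2)]] B_step[OF k IH(3)]] by simp
    then show ?case using sd B_step[OF k sd] V_mono[of k "Suc k"] by auto
  qed
  then show ?thesis using assms(4) by (cases "cheb B (e 0) k", cases "cheb (\<lambda>x. a * x) 1 k") auto
qed

text \<open>
  For $\mu < L$ the competitor is $T_n(B) e_0 / T_n(a)$, where $B$ and $a = (L + \mu)/(L - \mu)$ are the images of
  $A$ and $0$ under the affine map that takes $[\mu, L]$ onto $[-1, 1]$. Writing $a = (z + 1/z)/2$ with
  $z = (\sqrt{L/\mu} + 1)/(\sqrt{L/\mu} - 1)$ turns the denominator into at least $z^n/2$.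
\<close>

lemma chebyshev_bound:
  fixes \<mu> L :: real
  assumes "\<And>i. \<beta> i \<noteq> 0" and "\<And>i. 1 \<le> i \<Longrightarrow> i \<le> n \<Longrightarrow> P i \<noteq> 0"
    and \<mu>: "0 < \<mu>" "\<mu> \<le> L"
    and contr: "\<And>w. ip (((L + \<mu>)/2) *\<^sub>R w - A w) (((L + \<mu>)/2) *\<^sub>R w - A w) \<le> ((L - \<mu>)/2)\<^sup>2 * ip w w"
  shows "ip (ebar n) (ebar n) \<le> (2 * ((sqrt (L / \<mu>) - 1) / (sqrt (L / \<mu>) + 1)) ^ n)\<^sup>2 * ip (e 0) (e 0)"
proof (cases "L = \<mu>")
  case True
  show ?thesis
  proof (cases "n = 0")
    case True
    then show ?thesis using nonneg[of "e 0"] by (simp add: ebar P_0)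
  next
    case False
    \<comment> \<open>Here \<open>A\<close> is \<open>\<mu>\<close> times the identity, and one direction annihilates the error.\<close>
    let ?y = "e 0 - (1/\<mu>) *\<^sub>R A (e 0)"
    have "?y - e 0 \<in> V n" using A_e0_in_V[of n] assms(1) False unfolding V_def
      by (auto intro!: span_neg span_scale)
    then have le: "ip (ebar n) (ebar n) \<le> ip ?y ?y" by (intro ebar_minimal assms)
    have "ip (\<mu> *\<^sub>R e 0 - A (e 0)) (\<mu> *\<^sub>R e 0 - A (e 0)) = 0"
      using contr[of "e 0"] nonneg[of "\<mu> *\<^sub>R e 0 - A (e 0)"] True by simp
    then have "\<mu> *\<^sub>R e 0 = A (e 0)" by (simp add: eq_0_iff)
    then have "?y = 0" using \<mu> by (simp flip: \<open>\<mu> *\<^sub>R e 0 = A (e 0)\<close>)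
    then show ?thesis using le nonneg[of "ebar n"] nonneg[of "e 0"] by (simp add: ip_simps)
  qed
next
  case False
  then have L: "\<mu> < L" using \<mu> by simp
  define \<sigma> where "\<sigma> = sqrt (L / \<mu>)"
  have \<sigma>: "\<sigma> > 1" "L = \<sigma>^2 * \<mu>" using \<mu> L by (simp_all add: \<sigma>_def)
  define z where "z = (\<sigma> + 1)/(\<sigma> - 1)"
  have z: "z > 1" using \<sigma> by (simp add: z_def)
  have zb: "(z + 1/z)/2 = (L + \<mu>)/(L - \<mu>)"
  proof -
    have "\<sigma> - 1 \<noteq> 0" "\<sigma> + 1 \<noteq> 0" using \<sigma> by auto
    then have "(z + 1/z)/2 = ((\<sigma>+1)^2 + (\<sigma>-1)^2)/(2*((\<sigma>-1)*(\<sigma>+1)))"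
      by (simp add: z_def divide_simps power2_eq_square)
    also have "\<dots> = (\<sigma>^2+1)/(\<sigma>^2-1)"
      by (simp add: power2_eq_square algebra_simps divide_simps)
    also have "\<dots> = ((\<sigma>^2+1) * \<mu>)/((\<sigma>^2-1) * \<mu>)" using \<mu> by simp
    also have "\<dots> = (L + \<mu>)/(L - \<mu>)" unfolding \<sigma>(2) by (simp add: algebra_simps)
    finally show ?thesis .
  qed
  define a r where "a = (L + \<mu>)/(L - \<mu>)" and "r = 2/(L - \<mu>)"
  define B where "B = (\<lambda>x. a *\<^sub>R x - r *\<^sub>R A x)"
  have ra: "r * ((L + \<mu>)/2) = a" using L by (simp add: a_def r_def divide_simps) (simp add: algebra_simps)
  have B_eq: "B x = r *\<^sub>R (((L + \<mu>)/2) *\<^sub>R x - A x)" for x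
    unfolding B_def ra[symmetric] by (simp only: scaleR_diff_right scaleR_scaleR)
  have ip_scale: "ip (r *\<^sub>R y) (r *\<^sub>R y) = r\<^sup>2 * ip y y" for y
    by (simp add: ip_simps power2_eq_square)
  have "linear B" unfolding B_def
    by (intro linear_compose_sub linear_compose_scale_right linear linear_id[unfolded id_def])
  moreover have "ip (B u) w = ip u (B w)" for u w
    by (simp add: B_def ip_simps adjoint)
  moreover have "ip (B w) (B w) \<le> ip w w" for w
  proof -
    have "ip (B w) (B w) = r\<^sup>2 * ip (((L + \<mu>)/2) *\<^sub>R w - A w) (((L + \<mu>)/2) *\<^sub>R w - A w)"
      unfolding B_eq by (rule ip_scale)
    also have "\<dots> \<le> r\<^sup>2 * (((L - \<mu>)/2)\<^sup>2 * ip w w)"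
      by (intro mult_left_mono contr) simp
    also have "\<dots> = ip w w" using L by (simp add: r_def power_divide)
    finally show ?thesis .
  qed
  ultimately have le: "ip (fst (cheb B (e 0) n)) (fst (cheb B (e 0) n)) \<le> ip (e 0) (e 0)"
    by (rule cheb_contraction)
  define t where "t = fst (cheb B (e 0) n)"
  define c where "c = fst (cheb (\<lambda>x. a * x) 1 n)"
  have c: "c = (z^n + 1/z^n)/2" using cheb_scalar[OF z, of n] zb by (simp add: c_def a_def)
  moreover have "z^n > 0" "1/z^n > 0" using z by auto
  ultimately have c2: "c \<ge> z^n/2" by simp
  with \<open>z^n > 0\<close> have c_pos: "c > 0" by linarith
  have "t - c *\<^sub>R e 0 \<in> V n"
    unfolding t_def c_def B_def by (rule cheb_in_V[OF assms(1,2)]) auto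
  moreover have "(1/c) *\<^sub>R t - e 0 = (1/c) *\<^sub>R (t - c *\<^sub>R e 0)"
    using c2 c_pos by (simp add: algebra_simps)
  ultimately have "(1/c) *\<^sub>R t - e 0 \<in> V n" unfolding V_def by (auto intro: span_scale)
  then have "ip (ebar n) (ebar n) \<le> ip ((1/c) *\<^sub>R t) ((1/c) *\<^sub>R t)"
    by (intro ebar_minimal assms)
  also have "\<dots> = (1/c)\<^sup>2 * ip t t" by (simp add: ip_simps power2_eq_square)
  also have "\<dots> \<le> (1/c)\<^sup>2 * ip (e 0) (e 0)" using le by (intro mult_left_mono) (auto simp: t_def)
  also have "\<dots> \<le> (2 * (1/z)^n)\<^sup>2 * ip (e 0) (e 0)"
  proof (intro mult_right_mono power_mono nonneg)
    show "1/c \<le> 2 * (1/z)^n" using c2 c_pos z by (simp add: field_simps power_divide)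
  qed (use c_pos in auto)
  finally show ?thesis by (simp add: z_def \<sigma>_def)
qed

end

section \<open>Termination after as many directions as dimensions\<close>

lemma (in linear_cycle) P_Suc_notin_V:
  assumes "\<And>i. \<beta> i \<noteq> 0" and "\<And>i. 1 \<le> i \<Longrightarrow> i \<le> Suc n \<Longrightarrow> P i \<noteq> 0"
  shows "P (Suc n) \<notin> V n"
proof
  assume "P (Suc n) \<in> V n"
  then have "ip (P (Suc n)) (P (Suc n)) = 0"
    unfolding V_def
    by (rule orthogonal_span) (use cycle_invariants[of "Suc n", OF assms] in auto)
  then show False using assms(2)[of "Suc n"] by (simp add: eq_0_iff)
qed

text \<open>
  Each nonzero direction raises the dimension of the span by one, so finally the projected error is
  orthogonal to every vector.
\<close>

lemma full_cycle_exact: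
  fixes ip :: "'a::euclidean_space \<Rightarrow> 'a \<Rightarrow> real"
  assumes "linear_cycle ip A \<beta> e P ebar"
    and "\<And>i. \<beta> i \<noteq> 0" and "\<And>i. 1 \<le> i \<Longrightarrow> i \<le> DIM('a) \<Longrightarrow> P i \<noteq> 0"
  shows "ebar DIM('a) = 0"
proof -
  interpret linear_cycle ip A \<beta> e P ebar by fact
  have "dim (V n) = n" if "n \<le> DIM('a)" for n
    using that
  proof (induction n)
    case 0
    then show ?case by (simp add: V_0)
  next
    case (Suc n)
    have "P (Suc n) \<notin> V n" by (rule P_Suc_notin_V) (use assms Suc.prems in auto)
    then show ?case using Suc by (simp add: V_def atMost_Suc dim_insert)
  qed
  then have "span (V DIM('a)) = UNIV" by (simp flip: dim_eq_full)
  then have "ebar DIM('a) \<in> V DIM('a)" by (simp add: V_def span_span)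
  then have "ip (ebar DIM('a)) (ebar DIM('a)) = 0"
    unfolding V_def
    by (rule orthogonal_span) (use cycle_invariants[of "DIM('a)", OF assms(2,3)] in auto)
  then show ?thesis by (simp add: eq_0_iff)
qed

section \<open>Energy inner products of a positive definite matrix\<close>

text \<open>
  The matrix of this inner product is $A$ for Type I and $A^2$ for Type II; the associated norms are
  the energy norm of the error and the Euclidean norm of the linear residual.
\<close>

definition energy_form :: "am_type \<Rightarrow> real^'n^'n \<Rightarrow> real^'n \<Rightarrow> real^'n \<Rightarrow> real" where
  "energy_form ty A u w = (case ty of Type_I \<Rightarrow> u \<bullet> (A *v w) | Type_II \<Rightarrow> (A *v u) \<bullet> (A *v w))"

lemma symmetric_matrix_adjoint:
  fixes A :: "real^'n^'n"
  assumes "transpose A = A"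
  shows "(A *v u) \<bullet> w = u \<bullet> (A *v w)"
  by (metis assms dot_lmul_matrix transpose_matrix_vector)

locale spd_matrix =
  fixes A :: "real^'n^'n" and \<mu> L :: real
  assumes symmetric: "transpose A = A"
    and \<mu>_pos: "0 < \<mu>"
    and lower: "\<mu> * (norm y)\<^sup>2 \<le> y \<bullet> (A *v y)"
    and upper: "y \<bullet> (A *v y) \<le> L * (norm y)\<^sup>2"
begin

lemmas adj = symmetric_matrix_adjoint[OF symmetric]

lemma norm_lower: "\<mu> * norm y \<le> norm (A *v y)"
proof (cases "y = 0")
  case False
  have "\<mu> * norm y * norm y \<le> norm (A *v y) * norm y"
    using lower[of y] norm_cauchy_schwarz[of y "A *v y"] by (simp add: power2_eq_square mult.commute mult.left_commute)
  then show ?thesis using False by simp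
qed simp

lemma selfadjoint_energy_form: "selfadjoint_form (energy_form ty A) (matrix_vector_mult A)"
proof (rule selfadjoint_form.intro)
  show "bilinear (energy_form ty A)"
    by (cases ty) (auto simp: bilinear_def energy_form_def linear_iff algebra_simps inner_simps
        matrix_vector_right_distrib matrix_vector_mult_scaleR)
  show "energy_form ty A u w = energy_form ty A w u" for u w
  proof (cases ty)
    case Type_I
    then show ?thesis by (simp add: energy_form_def) (metis adj inner_commute)
  qed (simp add: energy_form_def inner_commute)
  show "0 < energy_form ty A u u" if "u \<noteq> 0" for u
  proof -
    have "0 < \<mu> * norm u" using that \<mu>_pos by simp
    then have *: "0 < norm (A *v u)" using norm_lower[of u] by linarith
    have "0 < \<mu> * (norm u)\<^sup>2" using that \<mu>_pos by simp
    then show ?thesis using * lower[of u] by (cases ty) (auto simp: energy_form_def)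
  qed
  show "linear (matrix_vector_mult A)" by simp
  show "energy_form ty A (A *v u) w = energy_form ty A u (A *v w)" for u w
    by (cases ty) (auto simp: energy_form_def adj)
qed

text \<open>
  This says that $X Y$ is positive semidefinite for $X = A - a$ and $Y = b - A$. As $X$ and $Y$ commute
  and $X + Y = b - a$, we have $(b - a) X Y = X Y X + Y X Y$, and both summands are positive
  semidefinite.
\<close>

lemma product_nonneg:
  assumes a: "\<And>y. a * (y \<bullet> y) \<le> y \<bullet> (A *v y)" and b: "\<And>y. y \<bullet> (A *v y) \<le> b * (y \<bullet> y)"
    and ab: "a \<le> b"
  shows "0 \<le> (a + b) * (u \<bullet> (A *v u)) - (A *v u) \<bullet> (A *v u) - a * b * (u \<bullet> u)"
proof -
  define X Y where "X = A *v u - a *\<^sub>R u" and "Y = b *\<^sub>R u - A *v u"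
  have uA: "u \<bullet> (A *v (A *v u)) = (A *v u) \<bullet> (A *v u)" by (simp add: adj)
  have *: "u \<bullet> (A *v u) = (A *v u) \<bullet> u" "(A *v (A *v u)) \<bullet> u = (A *v u) \<bullet> (A *v u)"
    "(A *v (A *v u)) \<bullet> (A *v u) = (A *v u) \<bullet> (A *v (A *v u))"
    using uA by (simp_all add: inner_commute)
  show ?thesis
  proof (cases "a = b")
    case True
    have q: "y \<bullet> (A *v y) = a * (y \<bullet> y)" for y using a[of y] b[of y] True by simp
    \<comment> \<open>By polarisation, \<open>A\<close> is \<open>a\<close> times the identity.\<close>
    have "u \<bullet> (A *v X) = X \<bullet> (A *v u)" by (metis adj inner_commute)
    moreover have "u \<bullet> X = X \<bullet> u" by (rule inner_commute)
    ultimately have "X \<bullet> (A *v u) = a * (X \<bullet> u)"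
      using q[of u] q[of X] q[of "u + X"]
      by (simp add: inner_add_left inner_add_right matrix_vector_right_distrib algebra_simps)
    moreover have "X \<bullet> X = X \<bullet> (A *v u) - a * (X \<bullet> u)"
      by (subst (2) X_def) (simp add: inner_diff_right)
    ultimately have "X \<bullet> X = 0" by simp
    then have "A *v u = a *\<^sub>R u" by (simp add: X_def)
    then show ?thesis using True by (simp add: algebra_simps)
  next
    case False
    \<comment> \<open>The forms of \<open>b - A\<close> at \<open>X\<close> and of \<open>A - a\<close> at \<open>Y\<close>.\<close>
    have "0 \<le> (b * (X \<bullet> X) - X \<bullet> (A *v X)) + (Y \<bullet> (A *v Y) - a * (Y \<bullet> Y))"
      using a[of Y] b[of X] by simp
    also have "\<dots> = (b - a) * ((a + b) * (u \<bullet> (A *v u)) - (A *v u) \<bullet> (A *v u) - a * b * (u \<bullet> u))"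
      by (simp add: X_def Y_def inner_simps matrix_vector_mult_diff_distrib
            matrix_vector_mult_scaleR uA algebra_simps *)
    finally show ?thesis using False ab by (simp add: zero_le_mult_iff)
  qed
qed

text \<open>
  With $X = A - a$ and $Y = b - A$, the difference of the two sides is the quadratic form of $S X Y$ at
  \<open>u\<close>, where $S$ is the matrix of the inner product. For $S = A^2$ this is the form of $X Y$ at $A u$.
  For $S = A = X + a$ it is the form of $Y$ at $X u$ plus $a$ times the form of $X Y$ at $u$.
\<close>

lemma shifted_contraction:
  assumes a: "\<And>y. a * (norm y)\<^sup>2 \<le> y \<bullet> (A *v y)" and b: "\<And>y. y \<bullet> (A *v y) \<le> b * (norm y)\<^sup>2"
    and ab: "0 \<le> a" "a \<le> b"
  shows "energy_form ty A (((b + a)/2) *\<^sub>R u - A *v u) (((b + a)/2) *\<^sub>R u - A *v u)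
           \<le> ((b - a)/2)\<^sup>2 * energy_form ty A u u"
proof -
  have a': "a * (y \<bullet> y) \<le> y \<bullet> (A *v y)" and b': "y \<bullet> (A *v y) \<le> b * (y \<bullet> y)" for y
    using a[of y] b[of y] by (simp_all add: power2_norm_eq_inner)
  note key = product_nonneg[OF a' b' ab(2)]
  have uA: "u \<bullet> (A *v (A *v u)) = (A *v u) \<bullet> (A *v u)" by (simp add: adj)
  have *: "u \<bullet> (A *v u) = (A *v u) \<bullet> u" "(A *v (A *v u)) \<bullet> u = (A *v u) \<bullet> (A *v u)"
    "(A *v (A *v u)) \<bullet> (A *v u) = (A *v u) \<bullet> (A *v (A *v u))"
    using uA by (simp_all add: inner_commute)
  have sq: "((b - a)/2)\<^sup>2 = ((b + a)/2)\<^sup>2 - a * b" by (simp add: power2_eq_square field_simps)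
  define c where "c = (b + a)/2"
  have "energy_form ty A (c *\<^sub>R u - A *v u) (c *\<^sub>R u - A *v u) \<le> (c\<^sup>2 - a*b) * energy_form ty A u u"
  proof (cases ty)
    case Type_II
    then have "(c\<^sup>2 - a*b) * energy_form ty A u u - energy_form ty A (c *\<^sub>R u - A *v u) (c *\<^sub>R u - A *v u)
      = 2 * c * ((A *v u) \<bullet> (A *v (A *v u))) - (A *v (A *v u)) \<bullet> (A *v (A *v u)) - a * b * ((A *v u) \<bullet> (A *v u))"
      by (simp add: energy_form_def inner_simps matrix_vector_mult_diff_distrib
            matrix_vector_mult_scaleR algebra_simps power2_eq_square *)
    then show ?thesis using key[of "A *v u"] by (simp add: c_def algebra_simps)
  next
    case Type_I
    define X where "X = A *v u - a *\<^sub>R u"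
    have "0 \<le> (b * (X \<bullet> X) - X \<bullet> (A *v X))
        + a * ((a + b) * (u \<bullet> (A *v u)) - (A *v u) \<bullet> (A *v u) - a * b * (u \<bullet> u))"
      using b'[of X] key[of u] ab by simp
    also have "\<dots> = 2 * c * ((A *v u) \<bullet> (A *v u)) - (A *v u) \<bullet> (A *v (A *v u)) - a * b * (u \<bullet> (A *v u))"
      by (simp add: c_def X_def inner_simps matrix_vector_mult_diff_distrib
            matrix_vector_mult_scaleR uA algebra_simps *)
    also have "\<dots> = (c\<^sup>2 - a*b) * energy_form ty A u u - energy_form ty A (c *\<^sub>R u - A *v u) (c *\<^sub>R u - A *v u)"
      using Type_I
      by (simp add: energy_form_def inner_simps matrix_vector_mult_diff_distrib
            matrix_vector_mult_scaleR algebra_simps power2_eq_square uA *)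
    finally show ?thesis by simp
  qed
  then show ?thesis unfolding sq by (simp add: c_def)
qed

lemma \<mu>_le_L: "\<mu> \<le> L"
proof -
  obtain y :: "real^'n" where "y \<noteq> 0" using zero_neq_one by metis
  then show ?thesis using order_trans[OF lower[of y] upper[of y]] by simp
qed

lemma mixing_quadratic_form:
  "\<bar>(norm y)\<^sup>2 - \<beta> * (y \<bullet> (A *v y))\<bar> \<le> spectral_norm (mat 1 - \<beta> *\<^sub>R A) * (norm y)\<^sup>2"
proof -
  let ?G = "mat 1 - \<beta> *\<^sub>R A"
  have G: "?G *v y = y - \<beta> *\<^sub>R (A *v y)"
    by (simp add: matrix_vector_mult_diff_rdistrib scaleR_matrix_vector_assoc)
  have "norm (?G *v y) \<le> spectral_norm ?G * norm y"
    unfolding spectral_norm_def by (rule onorm) (rule matrix_vector_mul_bounded_linear)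
  then have "\<bar>y \<bullet> (?G *v y)\<bar> \<le> norm y * (spectral_norm ?G * norm y)"
    using Cauchy_Schwarz_ineq2[of y "?G *v y"] by (meson mult_left_mono norm_ge_zero order_trans)
  then show ?thesis
    by (simp add: G inner_simps power2_norm_eq_inner[symmetric] power2_eq_square mult.commute mult.left_commute)
qed

lemma spectral_norm_nonneg: "0 \<le> spectral_norm (B :: real^'n^'n)"
  unfolding spectral_norm_def by (rule onorm_pos_le) (rule matrix_vector_mul_bounded_linear)

lemma mixing_bounds:
  assumes "spectral_norm (mat 1 - \<beta> *\<^sub>R A) \<le> \<theta>" "0 < \<beta>"
  shows "\<beta> \<le> (1 + \<theta>) / \<mu>" and "(1 - \<theta>) / L \<le> \<beta>"
proof -
  obtain y :: "real^'n" where y: "y \<noteq> 0" using zero_neq_one by metis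
  have "\<bar>(norm y)\<^sup>2 - \<beta> * (y \<bullet> (A *v y))\<bar> \<le> \<theta> * (norm y)\<^sup>2"
    using mixing_quadratic_form[of y \<beta>] mult_right_mono[OF assms(1), of "(norm y)\<^sup>2"] by simp
  then have 1: "\<beta> * (y \<bullet> (A *v y)) \<le> (1 + \<theta>) * (norm y)\<^sup>2" "(1 - \<theta>) * (norm y)\<^sup>2 \<le> \<beta> * (y \<bullet> (A *v y))"
    by (auto simp: abs_le_iff algebra_simps)
  have "\<beta> * \<mu> * (norm y)\<^sup>2 \<le> (1 + \<theta>) * (norm y)\<^sup>2"
    using order_trans[OF mult_left_mono[OF lower[of y]] 1(1)] assms(2) by (simp add: mult.assoc)
  then have "\<beta> * \<mu> \<le> 1 + \<theta>" using y by simp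
  then show "\<beta> \<le> (1 + \<theta>) / \<mu>" using \<mu>_pos by (simp add: field_simps)
  have "(1 - \<theta>) * (norm y)\<^sup>2 \<le> \<beta> * L * (norm y)\<^sup>2"
    using order_trans[OF 1(2) mult_left_mono[OF upper[of y]]] assms(2) by (simp add: mult.assoc)
  then have "1 - \<theta> \<le> \<beta> * L" using y by simp
  then show "(1 - \<theta>) / L \<le> \<beta>" using \<mu>_pos \<mu>_le_L by (simp add: field_simps)
qed

text \<open>
  If $\theta$ is the spectral norm of $I - \beta A$, the quadratic form of $A$ on unit vectors lies between
  $(1 - \theta)/\beta$ and $(1 + \theta)/\beta$, an interval with midpoint $1/\beta$ and radius
  $\theta/\beta$.
\<close>

lemma mixing_contraction:
  assumes "spectral_norm (mat 1 - \<beta> *\<^sub>R A) \<le> 1" "0 < \<beta>"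
  shows "energy_form ty A (u - \<beta> *\<^sub>R (A *v u)) (u - \<beta> *\<^sub>R (A *v u))
           \<le> (spectral_norm (mat 1 - \<beta> *\<^sub>R A))\<^sup>2 * energy_form ty A u u"
proof -
  let ?\<theta> = "spectral_norm (mat 1 - \<beta> *\<^sub>R A)"
  interpret F: selfadjoint_form "energy_form ty A" "matrix_vector_mult A" by (rule selfadjoint_energy_form)
  define a b where "a = (1 - ?\<theta>)/\<beta>" and "b = (1 + ?\<theta>)/\<beta>"
  have c: "(b + a)/2 = 1/\<beta>" and r: "(b - a)/2 = ?\<theta>/\<beta>"
    using assms by (simp_all add: a_def b_def field_simps)
  define w where "w = (1/\<beta>) *\<^sub>R u - A *v u"
  have "energy_form ty A w w \<le> (?\<theta>/\<beta>)\<^sup>2 * energy_form ty A u u"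
    unfolding w_def c[symmetric] r[symmetric]
  proof (rule shifted_contraction)
    fix y
    show "a * (norm y)\<^sup>2 \<le> y \<bullet> (A *v y)" "y \<bullet> (A *v y) \<le> b * (norm y)\<^sup>2"
      using mixing_quadratic_form[of y \<beta>] assms(2)
      by (auto simp: a_def b_def abs_le_iff field_simps)
    show "0 \<le> a" "a \<le> b" using assms spectral_norm_nonneg[of "mat 1 - \<beta> *\<^sub>R A"]
      by (auto simp: a_def b_def field_simps)
  qed
  then have "\<beta>\<^sup>2 * energy_form ty A w w \<le> ?\<theta>\<^sup>2 * energy_form ty A u u"
    using assms(2) by (simp add: field_simps power_divide)
  moreover have "u - \<beta> *\<^sub>R (A *v u) = \<beta> *\<^sub>R w" using assms(2) by (simp add: w_def algebra_simps)
  ultimately show ?thesis by (simp add: F.ip_simps power2_eq_square mult.assoc)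
qed

lemma energy_form_lower: "\<exists>c>0. \<forall>u. c * (norm u)\<^sup>2 \<le> energy_form ty A u u"
proof (cases ty)
  case Type_I
  then show ?thesis using lower \<mu>_pos by (intro exI[of _ \<mu>]) (simp add: energy_form_def)
next
  case Type_II
  have "\<mu>\<^sup>2 * (norm u)\<^sup>2 \<le> (A *v u) \<bullet> (A *v u)" for u
    using power_mono[OF norm_lower[of u], of 2] \<mu>_pos by (simp add: power_mult_distrib power2_norm_eq_inner)
  then show ?thesis using Type_II \<mu>_pos by (intro exI[of _ "\<mu>\<^sup>2"]) (simp add: energy_form_def)
qed

lemma energy_form_upper: "\<exists>c>0. \<forall>u. energy_form ty A u u \<le> c * (norm u)\<^sup>2"
proof (cases ty)
  case Type_I
  then show ?thesis using upper \<mu>_pos \<mu>_le_L by (intro exI[of _ L]) (simp add: energy_form_def)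
next
  case Type_II
  obtain B where B: "B > 0" "\<And>u. norm (A *v u) \<le> norm u * B"
    using bounded_linear.pos_bounded[OF matrix_vector_mul_bounded_linear[of A]] by blast
  have "(A *v u) \<bullet> (A *v u) \<le> B\<^sup>2 * (norm u)\<^sup>2" for u
    using power_mono[OF B(2)[of u], of 2] by (simp add: power_mult_distrib power2_norm_eq_inner mult.commute)
  then show ?thesis using Type_II B by (intro exI[of _ "B\<^sup>2"]) (simp add: energy_form_def)
qed

end

section \<open>The cycle of the linear residual\<close>

text \<open>
  The state consists of the current error and the last two directions, which is all that the short
  recurrence needs.
\<close>

primrec ideal_state :: "('a::real_vector \<Rightarrow> 'a \<Rightarrow> real) \<Rightarrow> ('a \<Rightarrow> 'a) \<Rightarrow> (nat \<Rightarrow> real) \<Rightarrow> 'a \<Rightarrow> nat \<Rightarrow> 'a \<times> 'a \<times> 'a" where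
  "ideal_state ip A \<beta> e\<^sub>0 0 = (e\<^sub>0, 0, 0)"
| "ideal_state ip A \<beta> e\<^sub>0 (Suc n) =
    (let (e, a, b) = ideal_state ip A \<beta> e\<^sub>0 n;
         u = ip_reduce ip b (ip_reduce ip a e);
         e' = u - \<beta> n *\<^sub>R A u
     in (e', b, ip_reduce ip b (ip_reduce ip a (e' - e))))"

definition ideal_err where "ideal_err ip A \<beta> e\<^sub>0 n = fst (ideal_state ip A \<beta> e\<^sub>0 n)"
definition ideal_dir where "ideal_dir ip A \<beta> e\<^sub>0 n = snd (snd (ideal_state ip A \<beta> e\<^sub>0 n))"
definition ideal_proj where
  "ideal_proj ip A \<beta> e\<^sub>0 n =
     ip_reduce ip (ideal_dir ip A \<beta> e\<^sub>0 n) (ip_reduce ip (ideal_dir ip A \<beta> e\<^sub>0 (n - 1)) (ideal_err ip A \<beta> e\<^sub>0 n))"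

lemma ideal_err_0: "ideal_err ip A \<beta> e\<^sub>0 0 = e\<^sub>0"
  by (simp add: ideal_err_def)

lemma ideal_linear_cycle:
  assumes "selfadjoint_form ip A"
  shows "linear_cycle ip A \<beta> (ideal_err ip A \<beta> e\<^sub>0) (ideal_dir ip A \<beta> e\<^sub>0) (ideal_proj ip A \<beta> e\<^sub>0)"
proof -
  interpret selfadjoint_form ip A by fact
  have prev: "fst (snd (ideal_state ip A \<beta> e\<^sub>0 n)) = ideal_dir ip A \<beta> e\<^sub>0 (n - 1)" for n
    by (cases n) (auto simp: ideal_dir_def Let_def split: prod.splits)
  have state: "ideal_state ip A \<beta> e\<^sub>0 n =
      (ideal_err ip A \<beta> e\<^sub>0 n, ideal_dir ip A \<beta> e\<^sub>0 (n - 1), ideal_dir ip A \<beta> e\<^sub>0 n)" for n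
    using prev[of n] by (simp add: ideal_err_def ideal_dir_def prod_eq_iff)
  show ?thesis
  proof (unfold_locales)
    show "ideal_dir ip A \<beta> e\<^sub>0 0 = 0" by (simp add: ideal_dir_def)
    fix i
    show "ideal_proj ip A \<beta> e\<^sub>0 i = ip_reduce ip (ideal_dir ip A \<beta> e\<^sub>0 i)
        (ip_reduce ip (ideal_dir ip A \<beta> e\<^sub>0 (i - 1)) (ideal_err ip A \<beta> e\<^sub>0 i))"
      by (simp add: ideal_proj_def)
    show e: "ideal_err ip A \<beta> e\<^sub>0 (Suc i) = ideal_proj ip A \<beta> e\<^sub>0 i - \<beta> i *\<^sub>R A (ideal_proj ip A \<beta> e\<^sub>0 i)"
      using state[of i] by (simp add: ideal_err_def[of _ _ _ _ "Suc i"] ideal_proj_def Let_def)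
    show "ideal_dir ip A \<beta> e\<^sub>0 (Suc i) = ip_reduce ip (ideal_dir ip A \<beta> e\<^sub>0 i)
        (ip_reduce ip (ideal_dir ip A \<beta> e\<^sub>0 (i - 1)) (ideal_err ip A \<beta> e\<^sub>0 (Suc i) - ideal_err ip A \<beta> e\<^sub>0 i))"
      using state[of i] unfolding e by (simp add: ideal_dir_def[of _ _ _ _ "Suc i"] ideal_proj_def Let_def)
  qed
qed

text \<open>
  Indices count from the start of the cycle. For \<open>i \<le> 1\<close> the pairs with index \<open>0\<close> are zero and leave
  \<open>z\<close> unchanged, which accounts for the lower loop bounds in the method.
\<close>

definition project :: "am_type \<Rightarrow> (nat \<Rightarrow> real^'n) \<Rightarrow> (nat \<Rightarrow> real^'n) \<Rightarrow> nat \<Rightarrow>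
    (real^'n) \<times> (real^'n) \<Rightarrow> (real^'n) \<times> (real^'n)" where
  "project ty P Q i z = reduce_pair ty (P i) (Q i) (reduce_pair ty (P (i - 1)) (Q (i - 1)) z)"

text \<open>
  One cycle with iterations \<open>0..n\<close>, reindexed to start at \<open>0\<close>. Of the restart tests, it records the
  lower bound on the denominators.
\<close>

definition restart_free :: "am_type \<Rightarrow> (real^'n \<Rightarrow> real^'n) \<Rightarrow> real \<Rightarrow> (nat \<Rightarrow> real) \<Rightarrow>
    (nat \<Rightarrow> real^'n) \<Rightarrow> (nat \<Rightarrow> real^'n) \<Rightarrow> (nat \<Rightarrow> real^'n) \<Rightarrow> nat \<Rightarrow> bool" where
  "restart_free ty g \<tau> \<beta> x P Q n \<longleftrightarrow> P 0 = 0 \<and> Q 0 = 0 \<and>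
     (\<forall>i\<le>n. let (xb, rb) = project ty P Q i (x i, residual g (x i)) in x (Suc i) = xb + \<beta> i *\<^sub>R rb) \<and>
     (\<forall>i<n. (P (Suc i), Q (Suc i)) =
        project ty P Q i (x (Suc i) - x i, residual g (x (Suc i)) - residual g (x i))) \<and>
     (\<forall>i. 1 \<le> i \<and> i \<le> n \<longrightarrow> \<tau> * \<bar>v_vec ty (P 1) (Q 1) \<bullet> Q 1\<bar> \<le> \<bar>v_vec ty (P i) (Q i) \<bullet> Q i\<bar>)"

lemma reduce_pair_shift:
  "reduce_pair ty p q (fst z - c, snd z) = (fst (reduce_pair ty p q z) - c, snd (reduce_pair ty p q z))"
  by (cases z) (simp add: reduce_pair_def Let_def algebra_simps)

lemma project_shift:
  "project ty P Q i (a - c, b) = (fst (project ty P Q i (a, b)) - c, snd (project ty P Q i (a, b)))"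
  unfolding project_def
  using reduce_pair_shift[of ty "P (i - 1)" "Q (i - 1)" "(a, b)" c]
    reduce_pair_shift[of ty "P i" "Q i" "reduce_pair ty (P (i - 1)) (Q (i - 1)) (a, b)" c]
  by simp

text \<open>
  For a linear residual the pairs stay on the graph of $-A$, on which a step of either loop is a
  projection in the energy inner product.
\<close>

lemma reduce_pair_linear:
  "reduce_pair ty p (- (A *v p)) (u, - (A *v u)) =
     (ip_reduce (energy_form ty A) p u, - (A *v ip_reduce (energy_form ty A) p u))"
  by (cases ty) (simp_all add: reduce_pair_def v_vec_def ip_reduce_def energy_form_def Let_def
      matrix_vector_mult_diff_distrib matrix_vector_mult_scaleR)

lemma abs_v_vec_linear:
  assumes "spd_matrix A \<mu> L"
  shows "\<bar>v_vec ty p (- (A *v p)) \<bullet> (- (A *v p))\<bar> = energy_form ty A p p"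
proof -
  interpret spd_matrix A \<mu> L by fact
  interpret F: selfadjoint_form "energy_form ty A" "matrix_vector_mult A" by (rule selfadjoint_energy_form)
  show ?thesis using F.nonneg[of p] by (cases ty) (auto simp: v_vec_def energy_form_def)
qed

section \<open>Quantities of first order and their second-order errors\<close>

text \<open>
  A filter expresses the uniformity of the constants. In the application it lives on the set of all
  cycles of a given length and \<open>E\<close> is the size of the initial error, so that a statement that holds
  eventually holds for all cycles whose initial error is small enough.
\<close>

locale vanishing_scale =
  fixes F :: "'w filter" and E :: "'w \<Rightarrow> real"
  assumes E_lim: "filterlim E (at_right 0) F"
begin

lemma E_pos: "eventually (\<lambda>\<omega>. 0 < E \<omega>) F"
  using E_lim by (auto simp: filterlim_at elim: eventually_mono)

lemma E_small: assumes "0 < e" shows "eventually (\<lambda>\<omega>. E \<omega> \<le> e) F"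
proof -
  have "(E \<longlongrightarrow> 0) F" using E_lim by (simp add: filterlim_at)
  then have "eventually (\<lambda>\<omega>. E \<omega> < e) F" using assms by (rule order_tendstoD(2))
  then show ?thesis by (rule eventually_mono) simp
qed

lemma E_power_mono: "k \<le> n \<Longrightarrow> (\<lambda>\<omega>. E \<omega> ^ n) \<in> O[F](\<lambda>\<omega>. E \<omega> ^ k)"
proof (rule landau_o.big_mono)
  assume "k \<le> n"
  show "\<forall>\<^sub>F \<omega> in F. norm (E \<omega> ^ n) \<le> norm (E \<omega> ^ k)"
    using E_pos E_small[OF zero_less_one]
    by eventually_elim (use \<open>k \<le> n\<close> in \<open>simp add: power_decreasing\<close>)
qed

lemma bigo_weaken: "f \<in> O[F](\<lambda>\<omega>. E \<omega> ^ n) \<Longrightarrow> k \<le> n \<Longrightarrow> f \<in> O[F](\<lambda>\<omega>. E \<omega> ^ k)"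
  using E_power_mono landau_o.big_trans by blast

lemma bigo_mult: "f \<in> O[F](\<lambda>\<omega>. E \<omega> ^ m) \<Longrightarrow> g \<in> O[F](\<lambda>\<omega>. E \<omega> ^ n) \<Longrightarrow>
    (\<lambda>\<omega>. f \<omega> * g \<omega>) \<in> O[F](\<lambda>\<omega>. E \<omega> ^ (m + n))"
  by (simp add: power_add landau_o.big.mult)

abbreviation vec_bigo :: "nat \<Rightarrow> ('w \<Rightarrow> 'v::real_normed_vector) \<Rightarrow> bool" where
  "vec_bigo n u \<equiv> (\<lambda>\<omega>. norm (u \<omega>)) \<in> O[F](\<lambda>\<omega>. E \<omega> ^ n)"

lemma vec_bigo_dominated:
  assumes "f \<in> O[F](\<lambda>\<omega>. E \<omega> ^ n)" "eventually (\<lambda>\<omega>. norm (u \<omega>) \<le> f \<omega>) F"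
  shows "vec_bigo n u"
proof (rule landau_o.big_trans[OF landau_o.big_mono assms(1)])
  show "\<forall>\<^sub>F \<omega> in F. norm (norm (u \<omega>)) \<le> norm (f \<omega>)"
    using assms(2) by eventually_elim auto
qed

lemma vec_bigo_add: "vec_bigo n u \<Longrightarrow> vec_bigo n w \<Longrightarrow> vec_bigo n (\<lambda>\<omega>. u \<omega> + w \<omega>)"
  by (rule vec_bigo_dominated[of "\<lambda>\<omega>. norm (u \<omega>) + norm (w \<omega>)"])
    (auto intro!: norm_triangle_ineq sum_in_bigo always_eventually)

lemma vec_bigo_diff: "vec_bigo n u \<Longrightarrow> vec_bigo n w \<Longrightarrow> vec_bigo n (\<lambda>\<omega>. u \<omega> - w \<omega>)"
  by (rule vec_bigo_dominated[of "\<lambda>\<omega>. norm (u \<omega>) + norm (w \<omega>)"])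
    (auto intro!: norm_triangle_ineq4 sum_in_bigo always_eventually)

lemma vec_bigo_scaleR: "c \<in> O[F](\<lambda>\<omega>. E \<omega> ^ m) \<Longrightarrow> vec_bigo n u \<Longrightarrow>
    vec_bigo (m + n) (\<lambda>\<omega>. c \<omega> *\<^sub>R u \<omega>)"
  using bigo_mult[of "\<lambda>\<omega>. \<bar>c \<omega>\<bar>" m "\<lambda>\<omega>. norm (u \<omega>)" n] by simp

lemma vec_bigo_linear:
  assumes "bounded_linear T" "vec_bigo n u" shows "vec_bigo n (\<lambda>\<omega>. T (u \<omega>))"
proof -
  obtain B where B: "\<And>x. norm (T x) \<le> norm x * B"
    using bounded_linear.bounded[OF assms(1)] by blast
  have "(\<lambda>\<omega>. norm (u \<omega>) * B) \<in> O[F](\<lambda>\<omega>. E \<omega> ^ n)"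
    using bigo_mult[OF assms(2), of "\<lambda>_. B" 0] by simp
  then show ?thesis by (rule vec_bigo_dominated) (simp add: B)
qed

lemma inner_bigo:
  fixes u w :: "'w \<Rightarrow> 'v::real_inner"
  assumes "vec_bigo m u" "vec_bigo n w"
  shows "(\<lambda>\<omega>. u \<omega> \<bullet> w \<omega>) \<in> O[F](\<lambda>\<omega>. E \<omega> ^ (m + n))"
proof -
  have "vec_bigo (m + n) (\<lambda>\<omega>. u \<omega> \<bullet> w \<omega>)"
    by (rule vec_bigo_dominated[OF bigo_mult[OF assms]]) (simp add: Cauchy_Schwarz_ineq2)
  then show ?thesis by simp
qed

text \<open>
  A first-order quantity together with an approximation up to second order.
\<close>

definition tracks :: "('w \<Rightarrow> 'v::real_normed_vector) \<Rightarrow> ('w \<Rightarrow> 'v) \<Rightarrow> bool" where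
  "tracks u u' \<longleftrightarrow> vec_bigo 1 u \<and> vec_bigo 2 (\<lambda>\<omega>. u \<omega> - u' \<omega>)"

lemma tracks_left: "tracks u u' \<Longrightarrow> vec_bigo 1 u"
  and tracks_error: "tracks u u' \<Longrightarrow> vec_bigo 2 (\<lambda>\<omega>. u \<omega> - u' \<omega>)"
  by (simp_all add: tracks_def)

lemma tracks_right: assumes "tracks u u'" shows "vec_bigo 1 u'"
proof -
  have "vec_bigo 1 (\<lambda>\<omega>. u \<omega> - u' \<omega>)"
    using bigo_weaken[OF tracks_error[OF assms], of 1] by simp
  from vec_bigo_diff[OF tracks_left[OF assms] this] show ?thesis by simp
qed

lemma tracks_cong:
  assumes "tracks u u'" "eventually (\<lambda>\<omega>. w \<omega> = u \<omega>) F" "eventually (\<lambda>\<omega>. w' \<omega> = u' \<omega>) F"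
  shows "tracks w w'"
  unfolding tracks_def
proof
  show "vec_bigo 1 w"
    by (rule vec_bigo_dominated[OF tracks_left[OF assms(1)]]) (use assms(2) in eventually_elim, simp)
  show "vec_bigo 2 (\<lambda>\<omega>. w \<omega> - w' \<omega>)"
    by (rule vec_bigo_dominated[OF tracks_error[OF assms(1)]]) (use assms(2,3) in eventually_elim, simp)
qed

lemma tracks_add: "tracks u u' \<Longrightarrow> tracks w w' \<Longrightarrow> tracks (\<lambda>\<omega>. u \<omega> + w \<omega>) (\<lambda>\<omega>. u' \<omega> + w' \<omega>)"
  unfolding tracks_def
  using vec_bigo_add[of u 1 w] vec_bigo_add[of "\<lambda>\<omega>. u \<omega> - u' \<omega>" 2 "\<lambda>\<omega>. w \<omega> - w' \<omega>"]
  by (simp add: algebra_simps)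

lemma tracks_scaleR:
  assumes c: "c \<in> O[F](\<lambda>_. 1)" and c': "c' \<in> O[F](\<lambda>_. 1)"
    and diff: "(\<lambda>\<omega>. c \<omega> - c' \<omega>) \<in> O[F](E)" and u: "tracks u u'"
  shows "tracks (\<lambda>\<omega>. c \<omega> *\<^sub>R u \<omega>) (\<lambda>\<omega>. c' \<omega> *\<^sub>R u' \<omega>)"
  unfolding tracks_def
proof
  show "vec_bigo 1 (\<lambda>\<omega>. c \<omega> *\<^sub>R u \<omega>)"
    using vec_bigo_scaleR[of c 0 u 1] c tracks_left[OF u] by simp
  have "vec_bigo 2 (\<lambda>\<omega>. (c \<omega> - c' \<omega>) *\<^sub>R u \<omega>)"
    using vec_bigo_scaleR[of "\<lambda>\<omega>. c \<omega> - c' \<omega>" 1 u 1] diff tracks_left[OF u] by (simp add: numeral_2_eq_2)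
  moreover have "vec_bigo 2 (\<lambda>\<omega>. c' \<omega> *\<^sub>R (u \<omega> - u' \<omega>))"
    using vec_bigo_scaleR[of c' 0 "\<lambda>\<omega>. u \<omega> - u' \<omega>" 2] c' tracks_error[OF u] by (simp add: numeral_2_eq_2)
  ultimately show "vec_bigo 2 (\<lambda>\<omega>. c \<omega> *\<^sub>R u \<omega> - c' \<omega> *\<^sub>R u' \<omega>)"
    using vec_bigo_add[of "\<lambda>\<omega>. (c \<omega> - c' \<omega>) *\<^sub>R u \<omega>" 2 "\<lambda>\<omega>. c' \<omega> *\<^sub>R (u \<omega> - u' \<omega>)"]
    by (simp add: algebra_simps)
qed

lemma tracks_scaleR_bounded: "c \<in> O[F](\<lambda>_. 1) \<Longrightarrow> tracks u u' \<Longrightarrow>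
    tracks (\<lambda>\<omega>. c \<omega> *\<^sub>R u \<omega>) (\<lambda>\<omega>. c \<omega> *\<^sub>R u' \<omega>)"
  by (rule tracks_scaleR) auto

lemma tracks_diff: "tracks u u' \<Longrightarrow> tracks w w' \<Longrightarrow> tracks (\<lambda>\<omega>. u \<omega> - w \<omega>) (\<lambda>\<omega>. u' \<omega> - w' \<omega>)"
  using tracks_add[of u u' "\<lambda>\<omega>. (- 1) *\<^sub>R w \<omega>" "\<lambda>\<omega>. (- 1) *\<^sub>R w' \<omega>"]
    tracks_scaleR_bounded[of "\<lambda>_. - 1" w w'] by simp

lemma tracks_linear:
  assumes "bounded_linear T" "tracks u u'" shows "tracks (\<lambda>\<omega>. T (u \<omega>)) (\<lambda>\<omega>. T (u' \<omega>))"
  using vec_bigo_linear[OF assms(1) tracks_left[OF assms(2)]]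
    vec_bigo_linear[OF assms(1) tracks_error[OF assms(2)]]
  by (simp add: tracks_def linear_diff[OF bounded_linear.linear[OF assms(1)]])

lemma tracks_inner:
  assumes "tracks u u'" "tracks w w'"
  shows "(\<lambda>\<omega>. u \<omega> \<bullet> w \<omega> - u' \<omega> \<bullet> w' \<omega>) \<in> O[F](\<lambda>\<omega>. E \<omega> ^ 3)"
proof -
  have "(\<lambda>\<omega>. (u \<omega> - u' \<omega>) \<bullet> w \<omega> + u' \<omega> \<bullet> (w \<omega> - w' \<omega>)) \<in> O[F](\<lambda>\<omega>. E \<omega> ^ 3)"
    using inner_bigo[OF tracks_error[OF assms(1)] tracks_left[OF assms(2)]]
      inner_bigo[OF tracks_right[OF assms(1)] tracks_error[OF assms(2)]]
    by (intro sum_in_bigo) (simp_all add: numeral_3_eq_3 numeral_2_eq_2)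
  then show ?thesis by (simp add: algebra_simps)
qed

lemma quadratic_lower_bound_nonzero:
  assumes "(\<lambda>\<omega>. E \<omega> ^ 2) \<in> O[F](f)"
  shows "eventually (\<lambda>\<omega>. f \<omega> \<noteq> 0) F"
proof -
  obtain c where "\<forall>\<^sub>F \<omega> in F. norm (E \<omega> ^ 2) \<le> c * norm (f \<omega>)"
    using assms by (rule landau_o.bigE)
  with E_pos show ?thesis by eventually_elim auto
qed

text \<open>
  An error of order 3 is negligible against a quantity that is bounded below at order 2.
\<close>

lemma quadratic_lower_bound_transfer:
  assumes lower: "(\<lambda>\<omega>. E \<omega> ^ 2) \<in> O[F](f)"
    and diff: "(\<lambda>\<omega>. f \<omega> - f' \<omega>) \<in> O[F](\<lambda>\<omega>. E \<omega> ^ 3)"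
  shows "(\<lambda>\<omega>. E \<omega> ^ 2) \<in> O[F](f')"
proof -
  obtain c where c: "c > 0" and low: "\<forall>\<^sub>F \<omega> in F. norm (E \<omega> ^ 2) \<le> c * norm (f \<omega>)"
    using lower by (rule landau_o.bigE)
  obtain d where d: "d > 0" and up: "\<forall>\<^sub>F \<omega> in F. norm (f \<omega> - f' \<omega>) \<le> d * norm (E \<omega> ^ 3)"
    using diff by (rule landau_o.bigE)
  have small: "\<forall>\<^sub>F \<omega> in F. E \<omega> \<le> 1 / (2 * c * d)" using c d by (intro E_small) simp
  have "\<forall>\<^sub>F \<omega> in F. norm (E \<omega> ^ 2) \<le> 2 * c * norm (f' \<omega>)"
    using low up E_pos small
  proof eventually_elim
    case (elim \<omega>)
    have "c * (d * E \<omega> ^ 3) = (c * d * E \<omega>) * E \<omega> ^ 2" by (simp add: numeral_3_eq_3 numeral_2_eq_2)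
    also have "\<dots> \<le> (1/2) * E \<omega> ^ 2"
      using elim c d by (intro mult_right_mono) (auto simp: field_simps)
    finally have 1: "c * (d * E \<omega> ^ 3) \<le> (1/2) * E \<omega> ^ 2" .
    have "norm (f \<omega>) \<le> norm (f' \<omega>) + d * E \<omega> ^ 3"
      using elim by (simp add: abs_if split: if_splits)
    then have "c * norm (f \<omega>) \<le> c * norm (f' \<omega>) + c * (d * E \<omega> ^ 3)"
      using mult_left_mono[of "norm (f \<omega>)" "norm (f' \<omega>) + d * E \<omega> ^ 3" c] c by (simp add: distrib_left)
    then have "E \<omega> ^ 2 \<le> c * norm (f' \<omega>) + (1/2) * E \<omega> ^ 2" using elim 1 by simp
    then show ?case by simp
  qed
  then show "(\<lambda>\<omega>. E \<omega> ^ 2) \<in> O[F](f')" by (rule bigoI)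
qed

lemma divide_quadratic:
  assumes "(\<lambda>\<omega>. E \<omega> ^ 2) \<in> O[F](g)" "f \<in> O[F](\<lambda>\<omega>. E \<omega> ^ (k + 2))"
  shows "(\<lambda>\<omega>. f \<omega> / g \<omega>) \<in> O[F](\<lambda>\<omega>. E \<omega> ^ k)"
proof -
  have "eventually (\<lambda>\<omega>. g \<omega> \<noteq> 0) F"
    by (rule quadratic_lower_bound_nonzero[OF assms(1)])
  moreover have "f \<in> O[F](\<lambda>\<omega>. E \<omega> ^ k * g \<omega>)"
    using landau_o.big_trans[OF assms(2)] landau_o.big.mult_left[OF assms(1), of "\<lambda>\<omega>. E \<omega> ^ k"]
    unfolding power_add by blast
  ultimately show ?thesis by (subst landau_o.big.divide_eq2)
qed

text \<open>
  A pair of directions along which a projection step is harmless: either it is zero and the step does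
  nothing, or its denominator is bounded below at order 2.
\<close>

definition usable :: "am_type \<Rightarrow> ('w \<Rightarrow> real^'n) \<Rightarrow> ('w \<Rightarrow> real^'n) \<Rightarrow> ('w \<Rightarrow> real^'n) \<Rightarrow> ('w \<Rightarrow> real^'n) \<Rightarrow> bool" where
  "usable ty p q p' q' \<longleftrightarrow> tracks p p' \<and> tracks q q' \<and>
     (eventually (\<lambda>\<omega>. p \<omega> = 0 \<and> q \<omega> = 0 \<and> p' \<omega> = 0 \<and> q' \<omega> = 0) F \<or>
      (\<lambda>\<omega>. E \<omega> ^ 2) \<in> O[F](\<lambda>\<omega>. v_vec ty (p \<omega>) (q \<omega>) \<bullet> q \<omega>))"

lemma tracks_v_vec: "tracks p p' \<Longrightarrow> tracks q q' \<Longrightarrow>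
    tracks (\<lambda>\<omega>. v_vec ty (p \<omega>) (q \<omega>)) (\<lambda>\<omega>. v_vec ty (p' \<omega>) (q' \<omega>))"
  by (cases ty) (simp_all add: v_vec_def)

text \<open>
  Unless the directions vanish, the coefficient is a quotient of quantities of order 2 with errors of
  order 3, and its denominator is bounded below at order 2. So it is bounded and
  has an error of order 1, which the multiplication with a direction turns into order 2.
\<close>

lemma tracks_reduce_pair:
  assumes dir: "usable ty p q p' q'" and ab: "tracks a a'" "tracks b b'"
  shows "tracks (\<lambda>\<omega>. fst (reduce_pair ty (p \<omega>) (q \<omega>) (a \<omega>, b \<omega>)))
                (\<lambda>\<omega>. fst (reduce_pair ty (p' \<omega>) (q' \<omega>) (a' \<omega>, b' \<omega>)))" (is ?A)
    and "tracks (\<lambda>\<omega>. snd (reduce_pair ty (p \<omega>) (q \<omega>) (a \<omega>, b \<omega>)))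
                (\<lambda>\<omega>. snd (reduce_pair ty (p' \<omega>) (q' \<omega>) (a' \<omega>, b' \<omega>)))" (is ?B)
proof -
  have p: "tracks p p'" and q: "tracks q q'" using dir by (simp_all add: usable_def)
  define v v' where "v = (\<lambda>\<omega>. v_vec ty (p \<omega>) (q \<omega>))" and "v' = (\<lambda>\<omega>. v_vec ty (p' \<omega>) (q' \<omega>))"
  have v: "tracks v v'" unfolding v_def v'_def by (rule tracks_v_vec[OF p q])
  show ?A ?B
  proof (atomize(full), cases "eventually (\<lambda>\<omega>. p \<omega> = 0 \<and> q \<omega> = 0 \<and> p' \<omega> = 0 \<and> q' \<omega> = 0) F")
    case True
    have "?A" by (rule tracks_cong[OF ab(1)]) (use True in eventually_elim, simp add: reduce_pair_def)+
    moreover have "?B" by (rule tracks_cong[OF ab(2)]) (use True in eventually_elim, simp add: reduce_pair_def)+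
    ultimately show "?A \<and> ?B" ..
  next
    case False
    define c c' where "c = (\<lambda>\<omega>. (v \<omega> \<bullet> b \<omega>) / (v \<omega> \<bullet> q \<omega>))" and "c' = (\<lambda>\<omega>. (v' \<omega> \<bullet> b' \<omega>) / (v' \<omega> \<bullet> q' \<omega>))"
    have den: "(\<lambda>\<omega>. E \<omega> ^ 2) \<in> O[F](\<lambda>\<omega>. v \<omega> \<bullet> q \<omega>)"
      using dir False by (simp add: usable_def v_def)
    have den_diff: "(\<lambda>\<omega>. v \<omega> \<bullet> q \<omega> - v' \<omega> \<bullet> q' \<omega>) \<in> O[F](\<lambda>\<omega>. E \<omega> ^ 3)"
      by (rule tracks_inner[OF v q])
    note den' = quadratic_lower_bound_transfer[OF den den_diff]
    have ne: "eventually (\<lambda>\<omega>. v \<omega> \<bullet> q \<omega> \<noteq> 0) F" "eventually (\<lambda>\<omega>. v' \<omega> \<bullet> q' \<omega> \<noteq> 0) F"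
      using quadratic_lower_bound_nonzero[OF den] quadratic_lower_bound_nonzero[OF den'] .
    have c: "c \<in> O[F](\<lambda>_. 1)"
      using divide_quadratic[OF den, of _ 0] inner_bigo[OF tracks_left[OF v] tracks_left[OF ab(2)]]
      by (simp add: c_def numeral_2_eq_2)
    have c': "c' \<in> O[F](\<lambda>_. 1)"
      using divide_quadratic[OF den', of _ 0] inner_bigo[OF tracks_right[OF v] tracks_right[OF ab(2)]]
      by (simp add: c'_def numeral_2_eq_2)
    have 1: "(\<lambda>\<omega>. (v \<omega> \<bullet> b \<omega> - v' \<omega> \<bullet> b' \<omega>) / (v \<omega> \<bullet> q \<omega>)) \<in> O[F](E)"
      using divide_quadratic[OF den, of _ 1] tracks_inner[OF v ab(2)] by (simp add: numeral_3_eq_3)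
    have 2: "(\<lambda>\<omega>. (v \<omega> \<bullet> q \<omega> - v' \<omega> \<bullet> q' \<omega>) / (v \<omega> \<bullet> q \<omega>)) \<in> O[F](E)"
      using divide_quadratic[OF den, of _ 1] den_diff by (simp add: numeral_3_eq_3)
    have "(\<lambda>\<omega>. (v \<omega> \<bullet> b \<omega> - v' \<omega> \<bullet> b' \<omega>) / (v \<omega> \<bullet> q \<omega>)
        - c' \<omega> * ((v \<omega> \<bullet> q \<omega> - v' \<omega> \<bullet> q' \<omega>) / (v \<omega> \<bullet> q \<omega>))) \<in> O[F](E)"
      using landau_o.big.mult[OF c' 2] by (intro sum_in_bigo(2) 1) simp
    also have "?this \<longleftrightarrow> (\<lambda>\<omega>. c \<omega> - c' \<omega>) \<in> O[F](E)"
    proof (rule landau_o.big.in_cong)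
      show "\<forall>\<^sub>F \<omega> in F. (v \<omega> \<bullet> b \<omega> - v' \<omega> \<bullet> b' \<omega>) / (v \<omega> \<bullet> q \<omega>)
        - c' \<omega> * ((v \<omega> \<bullet> q \<omega> - v' \<omega> \<bullet> q' \<omega>) / (v \<omega> \<bullet> q \<omega>)) = c \<omega> - c' \<omega>"
        using ne by eventually_elim (simp add: c_def c'_def field_simps)
    qed
    finally have cc: "(\<lambda>\<omega>. c \<omega> - c' \<omega>) \<in> O[F](E)" .
    show "?A \<and> ?B"
      using tracks_diff[OF ab(1) tracks_scaleR[OF c c' cc p]] tracks_diff[OF ab(2) tracks_scaleR[OF c c' cc q]]
      by (simp add: reduce_pair_def Let_def c_def c'_def v_def v'_def)
  qed
qed

end

section \<open>A cycle follows the cycle of the linear residual\<close>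

text \<open>
  A family of cycles with mixing parameters in a fixed interval \<open>[lb, ub]\<close>, for a residual that is
  linear up to a quadratic error near \<open>xs\<close>. It is compared with the family of linear cycles that have
  the same start and the same mixing parameters.
\<close>

locale perturbed_cycle = vanishing_scale F E + spd_matrix A \<mu> L
  for F :: "'w filter" and E :: "'w \<Rightarrow> real" and A :: "real^'n^'n" and \<mu> L +
  fixes ty :: am_type and g :: "real^'n \<Rightarrow> real^'n" and xs :: "real^'n" and \<rho> K \<tau> lb ub :: real
    and \<beta> :: "'w \<Rightarrow> nat \<Rightarrow> real" and x P Q :: "'w \<Rightarrow> nat \<Rightarrow> real^'n" and n :: nat
  assumes linearization: "z \<in> cball xs \<rho> \<Longrightarrow> norm (residual g z + A *v (z - xs)) \<le> K * (norm (z - xs))\<^sup>2"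
    and pos: "0 < \<rho>" "0 < \<tau>" "0 < lb"
    and mixing: "eventually (\<lambda>\<omega>. \<forall>i. lb \<le> \<beta> \<omega> i \<and> \<beta> \<omega> i \<le> ub) F"
    and cycle: "eventually (\<lambda>\<omega>. restart_free ty g \<tau> (\<beta> \<omega>) (x \<omega>) (P \<omega>) (Q \<omega>) n) F"
    and E_eq: "E \<omega> = norm (x \<omega> 0 - xs)"
begin

definition err where "err \<omega> = ideal_err (energy_form ty A) (matrix_vector_mult A) (\<beta> \<omega>) (x \<omega> 0 - xs)"
definition dir where "dir \<omega> = ideal_dir (energy_form ty A) (matrix_vector_mult A) (\<beta> \<omega>) (x \<omega> 0 - xs)"
definition proj where "proj \<omega> = ideal_proj (energy_form ty A) (matrix_vector_mult A) (\<beta> \<omega>) (x \<omega> 0 - xs)"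

lemma ideal: "linear_cycle (energy_form ty A) (matrix_vector_mult A) (\<beta> \<omega>) (err \<omega>) (dir \<omega>) (proj \<omega>)"
  unfolding err_def dir_def proj_def by (rule ideal_linear_cycle[OF selfadjoint_energy_form])

lemma err_0: "err \<omega> 0 = x \<omega> 0 - xs"
  by (simp add: err_def ideal_err_0)

lemma err_Suc: "err \<omega> (Suc i) = proj \<omega> i - \<beta> \<omega> i *\<^sub>R (A *v proj \<omega> i)"
  by (rule linear_cycle.e_Suc[OF ideal])

lemma project_err: "project ty (dir \<omega>) (\<lambda>i. - (A *v dir \<omega> i)) i (err \<omega> i, - (A *v err \<omega> i)) =
    (proj \<omega> i, - (A *v proj \<omega> i))"
  unfolding project_def reduce_pair_linear linear_cycle.ebar[OF ideal] ..

lemma project_dir: "project ty (dir \<omega>) (\<lambda>i. - (A *v dir \<omega> i)) i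
      (err \<omega> (Suc i) - err \<omega> i, - (A *v (err \<omega> (Suc i) - err \<omega> i))) =
    (dir \<omega> (Suc i), - (A *v dir \<omega> (Suc i)))"
  unfolding project_def reduce_pair_linear linear_cycle.P_Suc[OF ideal] ..

lemma \<beta>_bounded: "(\<lambda>\<omega>. \<beta> \<omega> i) \<in> O[F](\<lambda>_. 1)"
proof (rule bigoI)
  show "\<forall>\<^sub>F \<omega> in F. norm (\<beta> \<omega> i) \<le> ub * norm (1::real)"
    using mixing proof eventually_elim
    case (elim \<omega>)
    then have "lb \<le> \<beta> \<omega> i" "\<beta> \<omega> i \<le> ub" by simp_all
    then show ?case using pos by simp
  qed
qed

text \<open>
  A first-order quantity lies eventually in the ball of radius \<open>\<rho>\<close>, and there the quadratic error is
  of order 2.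
\<close>

lemma tracks_residual:
  assumes "tracks (\<lambda>\<omega>. u \<omega> - xs) e"
  shows "tracks (\<lambda>\<omega>. residual g (u \<omega>)) (\<lambda>\<omega>. - (A *v e \<omega>))"
proof -
  have u: "vec_bigo 1 (\<lambda>\<omega>. u \<omega> - xs)" by (rule tracks_left[OF assms])
  then obtain c where c: "c > 0" "\<forall>\<^sub>F \<omega> in F. norm (norm (u \<omega> - xs)) \<le> c * norm (E \<omega> ^ 1)"
    by (rule landau_o.bigE)
  have "\<forall>\<^sub>F \<omega> in F. E \<omega> \<le> \<rho> / c" using c pos by (intro E_small) simp
  with c(2) E_pos have ball: "\<forall>\<^sub>F \<omega> in F. u \<omega> \<in> cball xs \<rho>"
  proof eventually_elim
    case (elim \<omega>)
    then have "norm (u \<omega> - xs) \<le> c * E \<omega>" "c * E \<omega> \<le> \<rho>" using c by (simp_all add: field_simps)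
    then show ?case by (simp add: dist_norm norm_minus_commute)
  qed
  have "vec_bigo 2 (\<lambda>\<omega>. residual g (u \<omega>) + A *v (u \<omega> - xs))"
  proof (rule vec_bigo_dominated)
    show "(\<lambda>\<omega>. K * (norm (u \<omega> - xs))\<^sup>2) \<in> O[F](\<lambda>\<omega>. E \<omega> ^ 2)"
      using bigo_mult[OF u u] by (cases "K = 0") (simp_all add: power2_eq_square)
    show "\<forall>\<^sub>F \<omega> in F. norm (residual g (u \<omega>) + A *v (u \<omega> - xs)) \<le> K * (norm (u \<omega> - xs))\<^sup>2"
      using ball by eventually_elim (rule linearization)
  qed
  then have "vec_bigo 2 (\<lambda>\<omega>. residual g (u \<omega>) - (- (A *v (u \<omega> - xs))))" by simp
  moreover have lin: "tracks (\<lambda>\<omega>. - (A *v (u \<omega> - xs))) (\<lambda>\<omega>. - (A *v e \<omega>))"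
    by (rule tracks_linear[OF bounded_linear_minus[OF matrix_vector_mul_bounded_linear] assms])
  ultimately show ?thesis
    unfolding tracks_def
    using vec_bigo_add[OF bigo_weaken[of _ 2 1] tracks_left[OF lin], of "\<lambda>\<omega>. residual g (u \<omega>) - (- (A *v (u \<omega> - xs)))"]
      vec_bigo_add[OF _ tracks_error[OF lin], of "\<lambda>\<omega>. residual g (u \<omega>) - (- (A *v (u \<omega> - xs)))"]
    by simp
qed

text \<open>
  Only the fictitious direction with index \<open>0\<close> may be zero.
\<close>

definition usable_dir :: "nat \<Rightarrow> bool" where
  "usable_dir i \<longleftrightarrow> usable ty (\<lambda>\<omega>. P \<omega> i) (\<lambda>\<omega>. Q \<omega> i) (\<lambda>\<omega>. dir \<omega> i) (\<lambda>\<omega>. - (A *v dir \<omega> i)) \<and>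
     (0 < i \<longrightarrow> (\<lambda>\<omega>. E \<omega> ^ 2) \<in> O[F](\<lambda>\<omega>. v_vec ty (P \<omega> i) (Q \<omega> i) \<bullet> Q \<omega> i))"

lemma usable_dirD: "usable_dir i \<Longrightarrow>
    usable ty (\<lambda>\<omega>. P \<omega> i) (\<lambda>\<omega>. Q \<omega> i) (\<lambda>\<omega>. dir \<omega> i) (\<lambda>\<omega>. - (A *v dir \<omega> i))"
  by (simp add: usable_dir_def)

lemma tracks_project:
  assumes "usable_dir i" "usable_dir (i - 1)" "tracks a a'" "tracks b b'"
  shows "tracks (\<lambda>\<omega>. fst (project ty (P \<omega>) (Q \<omega>) i (a \<omega>, b \<omega>)))
                (\<lambda>\<omega>. fst (project ty (dir \<omega>) (\<lambda>i. - (A *v dir \<omega> i)) i (a' \<omega>, b' \<omega>)))"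
    and "tracks (\<lambda>\<omega>. snd (project ty (P \<omega>) (Q \<omega>) i (a \<omega>, b \<omega>)))
                (\<lambda>\<omega>. snd (project ty (dir \<omega>) (\<lambda>i. - (A *v dir \<omega> i)) i (a' \<omega>, b' \<omega>)))"
  using tracks_reduce_pair[OF usable_dirD[OF assms(1)]
      tracks_reduce_pair[OF usable_dirD[OF assms(2)] assms(3,4)]]
  by (simp_all add: project_def)

lemma tracks_next_err:
  assumes "i \<le> n" "usable_dir i" "usable_dir (i - 1)" "tracks (\<lambda>\<omega>. x \<omega> i - xs) (\<lambda>\<omega>. err \<omega> i)"
  shows "tracks (\<lambda>\<omega>. x \<omega> (Suc i) - xs) (\<lambda>\<omega>. err \<omega> (Suc i))"
proof -
  note pr = tracks_project[OF assms(2,3,4) tracks_residual[OF assms(4)]]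
  note t = tracks_add[OF pr(1) tracks_scaleR_bounded[OF \<beta>_bounded[of i] pr(2)]]
  show ?thesis
  proof (rule tracks_cong[OF t])
    show "\<forall>\<^sub>F \<omega> in F. x \<omega> (Suc i) - xs = fst (project ty (P \<omega>) (Q \<omega>) i (x \<omega> i - xs, residual g (x \<omega> i))) +
        \<beta> \<omega> i *\<^sub>R snd (project ty (P \<omega>) (Q \<omega>) i (x \<omega> i - xs, residual g (x \<omega> i)))"
      using cycle by eventually_elim
        (use assms(1) in \<open>auto simp: restart_free_def project_shift Let_def split: prod.splits\<close>)
    show "\<forall>\<^sub>F \<omega> in F. err \<omega> (Suc i) = fst (project ty (dir \<omega>) (\<lambda>i. - (A *v dir \<omega> i)) i (err \<omega> i, - (A *v err \<omega> i))) +
        \<beta> \<omega> i *\<^sub>R snd (project ty (dir \<omega>) (\<lambda>i. - (A *v dir \<omega> i)) i (err \<omega> i, - (A *v err \<omega> i)))"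
      by (simp add: project_err err_Suc)
  qed
qed

text \<open>
  The first direction of the linear cycle is \<open>-\<beta>\<^sub>0 A e\<^sub>0\<close>, and both \<open>\<beta>\<^sub>0\<close> and $A$ are bounded below.
\<close>

lemma first_direction_lower:
  "(\<lambda>\<omega>. E \<omega> ^ 2) \<in> O[F](\<lambda>\<omega>. v_vec ty (dir \<omega> 1) (- (A *v dir \<omega> 1)) \<bullet> (- (A *v dir \<omega> 1)))"
proof -
  obtain c where c: "c > 0" "\<And>u. c * (norm u)\<^sup>2 \<le> energy_form ty A u u"
    using energy_form_lower[of ty] by blast
  show ?thesis
  proof (rule bigoI)
    show "\<forall>\<^sub>F \<omega> in F. norm (E \<omega> ^ 2) \<le> 1 / (c * (lb * \<mu>)\<^sup>2) *
        norm (v_vec ty (dir \<omega> 1) (- (A *v dir \<omega> 1)) \<bullet> (- (A *v dir \<omega> 1)))"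
      using mixing
    proof eventually_elim
      case (elim \<omega>)
      have d: "dir \<omega> 1 = - (\<beta> \<omega> 0 *\<^sub>R (A *v (x \<omega> 0 - xs)))"
        using linear_cycle.P_1[OF ideal] err_0 by simp
      have \<beta>: "lb \<le> \<beta> \<omega> 0" using elim by simp
      have "lb * (\<mu> * E \<omega>) \<le> \<beta> \<omega> 0 * norm (A *v (x \<omega> 0 - xs))"
        unfolding E_eq using pos \<mu>_pos \<beta> norm_lower by (intro mult_mono) auto
      also have "\<dots> = norm (dir \<omega> 1)" using \<beta> pos unfolding d by simp
      finally have "(lb * \<mu> * E \<omega>)\<^sup>2 \<le> (norm (dir \<omega> 1))\<^sup>2"
        using pos \<mu>_pos E_eq[of \<omega>] by (intro power_mono) (auto simp: mult.assoc)
      then have "c * (lb * \<mu> * E \<omega>)\<^sup>2 \<le> energy_form ty A (dir \<omega> 1) (dir \<omega> 1)"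
        using c(1) c(2)[of "dir \<omega> 1"] by (meson mult_left_mono order_trans less_imp_le)
      moreover have "0 < c * (lb * \<mu>)\<^sup>2" using c pos \<mu>_pos by simp
      ultimately show ?case
        using abs_v_vec_linear[OF spd_matrix_axioms, of ty "dir \<omega> 1"]
        by (simp add: field_simps)
    qed
  qed
qed

text \<open>
  The denominator of the first direction is compared with that of the linear cycle; those of the later
  directions are bounded below by \<open>\<tau>\<close> times the first one.
\<close>

lemma next_usable_dir:
  assumes "i < n" "usable_dir i" "usable_dir (i - 1)"
    and e: "tracks (\<lambda>\<omega>. x \<omega> i - xs) (\<lambda>\<omega>. err \<omega> i)"
    and first: "0 < i \<Longrightarrow> usable_dir 1"
  shows "usable_dir (Suc i)"
proof -
  have e': "tracks (\<lambda>\<omega>. x \<omega> (Suc i) - xs) (\<lambda>\<omega>. err \<omega> (Suc i))"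
    using assms by (intro tracks_next_err) auto
  have 1: "tracks (\<lambda>\<omega>. x \<omega> (Suc i) - x \<omega> i) (\<lambda>\<omega>. err \<omega> (Suc i) - err \<omega> i)"
    using tracks_diff[OF e' e] by simp
  have 2: "tracks (\<lambda>\<omega>. residual g (x \<omega> (Suc i)) - residual g (x \<omega> i)) (\<lambda>\<omega>. - (A *v (err \<omega> (Suc i) - err \<omega> i)))"
    using tracks_diff[OF tracks_residual[OF e'] tracks_residual[OF e]]
    by (simp add: matrix_vector_mult_diff_distrib)
  note pr = tracks_project[OF assms(2,3) 1 2, unfolded project_dir fst_conv snd_conv]
  have PQ: "\<forall>\<^sub>F \<omega> in F. (P \<omega> (Suc i), Q \<omega> (Suc i)) = project ty (P \<omega>) (Q \<omega>) i
      (x \<omega> (Suc i) - x \<omega> i, residual g (x \<omega> (Suc i)) - residual g (x \<omega> i))"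
    using cycle by eventually_elim (use assms(1) in \<open>auto simp: restart_free_def\<close>)
  have tP: "tracks (\<lambda>\<omega>. P \<omega> (Suc i)) (\<lambda>\<omega>. dir \<omega> (Suc i))"
    by (rule tracks_cong[OF pr(1)]) (use PQ in eventually_elim, auto simp: prod_eq_iff)
  have tQ: "tracks (\<lambda>\<omega>. Q \<omega> (Suc i)) (\<lambda>\<omega>. - (A *v dir \<omega> (Suc i)))"
    by (rule tracks_cong[OF pr(2)]) (use PQ in eventually_elim, auto simp: prod_eq_iff)
  have "(\<lambda>\<omega>. E \<omega> ^ 2) \<in> O[F](\<lambda>\<omega>. v_vec ty (P \<omega> (Suc i)) (Q \<omega> (Suc i)) \<bullet> Q \<omega> (Suc i))"
  proof (cases "i = 0")
    case True
    have "(\<lambda>\<omega>. v_vec ty (dir \<omega> 1) (- (A *v dir \<omega> 1)) \<bullet> (- (A *v dir \<omega> 1)) -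
        v_vec ty (P \<omega> 1) (Q \<omega> 1) \<bullet> Q \<omega> 1) \<in> O[F](\<lambda>\<omega>. E \<omega> ^ 3)"
      using tracks_inner[OF tracks_v_vec[OF tP tQ] tQ, of ty] True
      by (subst landau_o.big.uminus_in_iff[symmetric]) simp
    from quadratic_lower_bound_transfer[OF first_direction_lower this] show ?thesis
      using True by simp
  next
    case False
    have lim: "(\<lambda>\<omega>. E \<omega> ^ 2) \<in> O[F](\<lambda>\<omega>. v_vec ty (P \<omega> 1) (Q \<omega> 1) \<bullet> Q \<omega> 1)"
      using first False by (simp add: usable_dir_def)
    have "\<forall>\<^sub>F \<omega> in F. norm (v_vec ty (P \<omega> 1) (Q \<omega> 1) \<bullet> Q \<omega> 1) \<le>
        (1/\<tau>) * norm (v_vec ty (P \<omega> (Suc i)) (Q \<omega> (Suc i)) \<bullet> Q \<omega> (Suc i))"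
      using cycle
    proof eventually_elim
      case (elim \<omega>)
      then have "\<tau> * \<bar>v_vec ty (P \<omega> 1) (Q \<omega> 1) \<bullet> Q \<omega> 1\<bar> \<le> \<bar>v_vec ty (P \<omega> (Suc i)) (Q \<omega> (Suc i)) \<bullet> Q \<omega> (Suc i)\<bar>"
        using assms(1) unfolding restart_free_def by (metis One_nat_def Suc_leI le_add1 plus_1_eq_Suc)
      then show ?case using pos by (simp add: field_simps)
    qed
    from landau_o.big_trans[OF lim bigoI[OF this]] show ?thesis .
  qed
  then show ?thesis using tP tQ by (simp add: usable_dir_def usable_def)
qed

lemma usable_dir_0: "usable_dir 0"
proof -
  have "\<forall>\<^sub>F \<omega> in F. P \<omega> 0 = 0 \<and> Q \<omega> 0 = 0 \<and> dir \<omega> 0 = 0 \<and> - (A *v dir \<omega> 0) = 0"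
    using cycle by eventually_elim (simp add: restart_free_def linear_cycle.P_0[OF ideal])
  moreover have "tracks (\<lambda>\<omega>. 0) (\<lambda>\<omega>. 0)" by (simp add: tracks_def)
  moreover have "tracks (\<lambda>\<omega>. P \<omega> 0) (\<lambda>\<omega>. dir \<omega> 0)"
    by (rule tracks_cong[OF calculation(2)]; rule eventually_mono[OF calculation(1)]; simp)
  moreover have "tracks (\<lambda>\<omega>. Q \<omega> 0) (\<lambda>\<omega>. - (A *v dir \<omega> 0))"
    by (rule tracks_cong[OF calculation(2)]; rule eventually_mono[OF calculation(1)]; simp)
  ultimately show ?thesis
    unfolding usable_dir_def usable_def by blast
qed

lemma tracks_cycle:
  assumes "i \<le> n"
  shows "tracks (\<lambda>\<omega>. x \<omega> i - xs) (\<lambda>\<omega>. err \<omega> i) \<and> usable_dir i"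
  using assms
proof (induction i rule: less_induct)
  case (less i)
  show ?case
  proof (cases i)
    case 0
    have "vec_bigo 1 (\<lambda>\<omega>. x \<omega> 0 - xs)" by (simp add: E_eq[abs_def])
    then have "tracks (\<lambda>\<omega>. x \<omega> 0 - xs) (\<lambda>\<omega>. err \<omega> 0)" by (simp add: tracks_def err_0)
    then show ?thesis using 0 usable_dir_0 by simp
  next
    case (Suc j)
    have "tracks (\<lambda>\<omega>. x \<omega> j - xs) (\<lambda>\<omega>. err \<omega> j)" "usable_dir j" "usable_dir (j - 1)"
      using less Suc by auto
    moreover have "usable_dir 1" if "0 < j" using less.IH[of 1] less.prems Suc that by auto
    ultimately show ?thesis using tracks_next_err[of j] next_usable_dir[of j] less.prems Suc by auto
  qed
qed

lemma directions_nonzero: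
  "\<forall>\<^sub>F \<omega> in F. \<forall>i. 1 \<le> i \<and> i \<le> n \<longrightarrow> dir \<omega> i \<noteq> 0"
proof -
  have "\<forall>\<^sub>F \<omega> in F. \<forall>i\<in>{1..n}. dir \<omega> i \<noteq> 0"
  proof (rule eventually_ball_finite)
    show "\<forall>i\<in>{1..n}. \<forall>\<^sub>F \<omega> in F. dir \<omega> i \<noteq> 0"
    proof
      fix i assume i: "i \<in> {1..n}"
      then have u: "usable_dir i" using tracks_cycle by simp
      then have t: "tracks (\<lambda>\<omega>. P \<omega> i) (\<lambda>\<omega>. dir \<omega> i)"
          "tracks (\<lambda>\<omega>. Q \<omega> i) (\<lambda>\<omega>. - (A *v dir \<omega> i))"
        by (simp_all add: usable_dir_def usable_def)
      have "(\<lambda>\<omega>. E \<omega> ^ 2) \<in> O[F](\<lambda>\<omega>. v_vec ty (P \<omega> i) (Q \<omega> i) \<bullet> Q \<omega> i)"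
        using u i by (simp add: usable_dir_def)
      note q = quadratic_lower_bound_transfer[OF this tracks_inner[OF tracks_v_vec[OF t] t(2)]]
      have "\<forall>\<^sub>F \<omega> in F. v_vec ty (dir \<omega> i) (- (A *v dir \<omega> i)) \<bullet> (- (A *v dir \<omega> i)) \<noteq> 0"
        by (rule quadratic_lower_bound_nonzero[OF q])
      then show "\<forall>\<^sub>F \<omega> in F. dir \<omega> i \<noteq> 0" by (rule eventually_mono) auto
    qed
  qed simp
  then show ?thesis by (auto elim: eventually_mono)
qed

end

section \<open>Error bounds for one cycle\<close>

text \<open>
  The second of the four bounds is the one that keeps a run close to the solution; the others are the
  rates of convergence.
\<close>

definition cycle_bounds :: "am_type \<Rightarrow> real^'n^'n \<Rightarrow> real \<Rightarrow> real \<Rightarrow> (real^'n \<Rightarrow> real^'n) \<Rightarrow> real^'n \<Rightarrow>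
    real \<Rightarrow> (nat \<Rightarrow> real) \<Rightarrow> (nat \<Rightarrow> real^'n) \<Rightarrow> nat \<Rightarrow> bool" where
  "cycle_bounds ty A \<mu> L g xs C \<beta> x n \<longleftrightarrow>
    (let N = (\<lambda>u. sqrt (energy_form ty A u u));
         \<theta> = spectral_norm (mat 1 - \<beta> n *\<^sub>R A);
         \<gamma> = ((sqrt (L / \<mu>) - 1) / (sqrt (L / \<mu>) + 1)) ^ n;
         R = C * (norm (x 0 - xs))\<^sup>2
     in N (x (Suc n) - xs) \<le> 2 * \<theta> * \<gamma> * N (x 0 - xs) + R \<and>
        N (x (Suc n) - xs) \<le> \<theta> * N (x 0 - xs) + R \<and>
        (ty = Type_II \<longrightarrow> norm (residual g (x (Suc n))) \<le> 2 * \<theta> * \<gamma> * norm (residual g (x 0)) + R) \<and>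
        (n = CARD('n) \<longrightarrow> norm (x (Suc n) - xs) \<le> R))"

lemma cycle_bounds_mono:
  assumes "cycle_bounds ty A \<mu> L g xs C \<beta> x n" "C \<le> C'"
  shows "cycle_bounds ty A \<mu> L g xs C' \<beta> x n"
proof -
  have "C * (norm (x 0 - xs))\<^sup>2 \<le> C' * (norm (x 0 - xs))\<^sup>2"
    using assms(2) by (intro mult_right_mono) auto
  then show ?thesis using assms(1) unfolding cycle_bounds_def Let_def by fastforce
qed

context spd_matrix
begin

lemma rate_bounds:
  "0 \<le> (sqrt (L / \<mu>) - 1) / (sqrt (L / \<mu>) + 1)" "(sqrt (L / \<mu>) - 1) / (sqrt (L / \<mu>) + 1) \<le> 1"
proof -
  define \<sigma> where "\<sigma> = sqrt (L / \<mu>)"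
  have "\<sigma> \<ge> 1" unfolding \<sigma>_def using \<mu>_pos \<mu>_le_L by simp
  then show "0 \<le> (sqrt (L / \<mu>) - 1) / (sqrt (L / \<mu>) + 1)" "(sqrt (L / \<mu>) - 1) / (sqrt (L / \<mu>) + 1) \<le> 1"
    unfolding \<sigma>_def[symmetric] by (simp_all add: field_simps)
qed

text \<open>
  Projection, estimated by Chebyshev polynomials or just as a contraction, followed by one mixing step.
\<close>

lemma ideal_cycle_bounds:
  fixes ty and \<beta> :: "nat \<Rightarrow> real" and e\<^sub>0 and n :: nat
  defines "e \<equiv> ideal_err (energy_form ty A) (matrix_vector_mult A) \<beta> e\<^sub>0"
    and "P \<equiv> ideal_dir (energy_form ty A) (matrix_vector_mult A) \<beta> e\<^sub>0"
    and "N \<equiv> \<lambda>u. sqrt (energy_form ty A u u)"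
    and "\<theta> \<equiv> spectral_norm (mat 1 - \<beta> n *\<^sub>R A)"
  assumes \<beta>: "\<And>i. 0 < \<beta> i" "\<theta> \<le> 1"
    and P: "\<And>i. 1 \<le> i \<Longrightarrow> i \<le> n \<Longrightarrow> P i \<noteq> 0"
  shows "N (e (Suc n)) \<le> 2 * \<theta> * ((sqrt (L / \<mu>) - 1) / (sqrt (L / \<mu>) + 1)) ^ n * N e\<^sub>0"
    and "N (e (Suc n)) \<le> \<theta> * N e\<^sub>0"
    and "n = CARD('n) \<Longrightarrow> e (Suc n) = 0"
proof -
  define ebar where "ebar = ideal_proj (energy_form ty A) (matrix_vector_mult A) \<beta> e\<^sub>0"
  have lc: "linear_cycle (energy_form ty A) (matrix_vector_mult A) \<beta> e P ebar"
    unfolding e_def P_def ebar_def by (rule ideal_linear_cycle[OF selfadjoint_energy_form])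
  interpret linear_cycle "energy_form ty A" "matrix_vector_mult A" \<beta> e P ebar by (rule lc)
  have e0: "e 0 = e\<^sub>0" by (simp add: e_def ideal_err_0)
  have \<beta>0: "\<beta> i \<noteq> 0" for i using \<beta>(1)[of i] by simp
  have \<theta>0: "0 \<le> \<theta>" unfolding \<theta>_def by (rule spectral_norm_nonneg)
  have sqrt_le: "N u \<le> c * N w" if "energy_form ty A u u \<le> c\<^sup>2 * energy_form ty A w w" "0 \<le> c" for u w c
    using real_sqrt_le_mono[OF that(1)] that(2) by (simp add: N_def real_sqrt_mult)
  have step: "N (e (Suc n)) \<le> \<theta> * N (ebar n)"
    using mixing_contraction[OF \<beta>(2)[unfolded \<theta>_def] \<beta>(1), of ty "ebar n"] \<theta>0
    by (intro sqrt_le) (simp_all add: e_Suc \<theta>_def)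
  have "N (ebar n) \<le> (2 * ((sqrt (L / \<mu>) - 1) / (sqrt (L / \<mu>) + 1)) ^ n) * N e\<^sub>0"
  proof (rule sqrt_le)
    show "energy_form ty A (ebar n) (ebar n)
        \<le> (2 * ((sqrt (L / \<mu>) - 1) / (sqrt (L / \<mu>) + 1)) ^ n)\<^sup>2 * energy_form ty A e\<^sub>0 e\<^sub>0"
      unfolding e0[symmetric]
      by (rule chebyshev_bound[OF \<beta>0 P \<mu>_pos \<mu>_le_L])
        (use shifted_contraction[OF lower upper] \<mu>_pos \<mu>_le_L in auto)
  qed (use rate_bounds(1) in simp)
  from order_trans[OF step mult_left_mono[OF this \<theta>0]]
  show "N (e (Suc n)) \<le> 2 * \<theta> * ((sqrt (L / \<mu>) - 1) / (sqrt (L / \<mu>) + 1)) ^ n * N e\<^sub>0"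
    by (simp add: mult_ac)
  have "energy_form ty A (ebar n) (ebar n) \<le> energy_form ty A (e 0) (e 0)"
    by (rule ebar_minimal[OF \<beta>0 P]) (simp_all add: V_def span_0)
  then have "N (ebar n) \<le> N e\<^sub>0" by (simp add: N_def e0)
  from order_trans[OF step mult_left_mono[OF this \<theta>0]] show "N (e (Suc n)) \<le> \<theta> * N e\<^sub>0" .
  show "e (Suc n) = 0" if "n = CARD('n)"
  proof -
    have "ebar n = 0" using full_cycle_exact[OF lc \<beta>0] P that by simp
    then show ?thesis by (simp add: e_Suc)
  qed
qed

end

context perturbed_cycle
begin

lemma eventually_cycle_bounds:
  assumes admissible: "\<forall>\<^sub>F \<omega> in F. \<forall>i. 0 < \<beta> \<omega> i \<and> spectral_norm (mat 1 - \<beta> \<omega> i *\<^sub>R A) \<le> 1"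
  shows "\<exists>C. \<forall>\<^sub>F \<omega> in F. cycle_bounds ty A \<mu> L g xs C (\<beta> \<omega>) (x \<omega>) n"
proof -
  have tn: "tracks (\<lambda>\<omega>. x \<omega> n - xs) (\<lambda>\<omega>. err \<omega> n)" "usable_dir n" "usable_dir (n - 1)"
    using tracks_cycle[of n] tracks_cycle[of "n - 1"] by auto
  have t: "tracks (\<lambda>\<omega>. x \<omega> (Suc n) - xs) (\<lambda>\<omega>. err \<omega> (Suc n))"
    by (rule tracks_next_err[OF order_refl tn(2,3,1)])
  have t0: "tracks (\<lambda>\<omega>. x \<omega> 0 - xs) (\<lambda>\<omega>. err \<omega> 0)" using tracks_cycle[of 0] by simp
  obtain C1 where C1: "C1 > 0" "\<forall>\<^sub>F \<omega> in F. norm (norm (x \<omega> (Suc n) - xs - err \<omega> (Suc n))) \<le> C1 * norm (E \<omega> ^ 2)"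
    using tracks_error[OF t] by (rule landau_o.bigE)
  obtain C2 where C2: "C2 > 0" "\<forall>\<^sub>F \<omega> in F. norm (norm (residual g (x \<omega> (Suc n)) - - (A *v err \<omega> (Suc n)))) \<le> C2 * norm (E \<omega> ^ 2)"
    using tracks_error[OF tracks_residual[OF t]] by (rule landau_o.bigE)
  obtain C3 where C3: "C3 > 0" "\<forall>\<^sub>F \<omega> in F. norm (norm (residual g (x \<omega> 0) - - (A *v err \<omega> 0))) \<le> C3 * norm (E \<omega> ^ 2)"
    using tracks_error[OF tracks_residual[OF t0]] by (rule landau_o.bigE)
  obtain c where c: "c > 0" "\<And>u. energy_form ty A u u \<le> c * (norm u)\<^sup>2"
    using energy_form_upper[of ty] by blast
  interpret S: selfadjoint_form "energy_form ty A" "matrix_vector_mult A" by (rule selfadjoint_energy_form)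
  define N where "N = (\<lambda>u. sqrt (energy_form ty A u u))"
  have N_le: "N u \<le> sqrt c * norm u" for u
    using real_sqrt_le_mono[OF c(2)[of u]] by (simp add: N_def real_sqrt_mult)
  define \<gamma> where "\<gamma> = ((sqrt (L / \<mu>) - 1) / (sqrt (L / \<mu>) + 1)) ^ n"
  have \<gamma>: "0 \<le> \<gamma>" "\<gamma> \<le> 1" unfolding \<gamma>_def using rate_bounds by (auto intro: power_le_one)
  define C where "C = sqrt c * C1 + C1 + C2 + 2 * C3"
  have "\<forall>\<^sub>F \<omega> in F. cycle_bounds ty A \<mu> L g xs C (\<beta> \<omega>) (x \<omega>) n"
    using C1(2) C2(2) C3(2) admissible directions_nonzero
  proof eventually_elim
    case (elim \<omega>)
    define \<theta> where "\<theta> = spectral_norm (mat 1 - \<beta> \<omega> n *\<^sub>R A)"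
    have \<theta>: "0 \<le> \<theta>" "\<theta> \<le> 1" using elim spectral_norm_nonneg by (auto simp: \<theta>_def)
    note b = ideal_cycle_bounds[of "\<beta> \<omega>" n ty "x \<omega> 0 - xs", folded err_def dir_def N_def \<theta>_def \<gamma>_def]
    have b1: "N (err \<omega> (Suc n)) \<le> 2 * \<theta> * \<gamma> * N (x \<omega> 0 - xs)"
      and b2: "N (err \<omega> (Suc n)) \<le> \<theta> * N (x \<omega> 0 - xs)"
      and b3: "n = CARD('n) \<Longrightarrow> err \<omega> (Suc n) = 0"
      using b elim \<theta> by (auto simp: N_def)
    define R where "R = C * (norm (x \<omega> 0 - xs))\<^sup>2"
    define r where "r = (norm (x \<omega> 0 - xs))\<^sup>2"
    have r: "0 \<le> r" by (simp add: r_def)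
    have e1: "norm (x \<omega> (Suc n) - xs - err \<omega> (Suc n)) \<le> C1 * r"
      and e2: "norm (residual g (x \<omega> (Suc n)) + A *v err \<omega> (Suc n)) \<le> C2 * r"
      and e3: "norm (residual g (x \<omega> 0) + A *v (x \<omega> 0 - xs)) \<le> C3 * r"
      using elim by (simp_all add: r_def E_eq err_0)
    have R: "R = sqrt c * (C1 * r) + C1 * r + C2 * r + 2 * (C3 * r)"
      by (simp add: R_def C_def r_def algebra_simps)
    have nn: "0 \<le> sqrt c * (C1 * r)" "0 \<le> C1 * r" "0 \<le> C2 * r" "0 \<le> C3 * r"
      using c(1) C1(1) C2(1) C3(1) r by auto
    have "N (x \<omega> (Suc n) - xs) \<le> N (err \<omega> (Suc n)) + N (x \<omega> (Suc n) - xs - err \<omega> (Suc n))"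
      using S.triangle[of "err \<omega> (Suc n)" "x \<omega> (Suc n) - xs - err \<omega> (Suc n)"] by (simp add: N_def)
    moreover have "N (x \<omega> (Suc n) - xs - err \<omega> (Suc n)) \<le> sqrt c * (C1 * r)"
      using order_trans[OF N_le mult_left_mono[OF e1]] c(1) by simp
    ultimately have N: "N (x \<omega> (Suc n) - xs) \<le> N (err \<omega> (Suc n)) + R"
      unfolding R using nn by linarith
    have "norm (residual g (x \<omega> (Suc n))) \<le> 2 * \<theta> * \<gamma> * norm (residual g (x \<omega> 0)) + R" if "ty = Type_II"
    proof -
      have NA: "N u = norm (A *v u)" for u using that by (simp add: N_def energy_form_def norm_eq_sqrt_inner)
      have "norm (residual g (x \<omega> (Suc n))) \<le> norm (A *v err \<omega> (Suc n)) + C2 * r"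
        using norm_triangle_ineq4[of "residual g (x \<omega> (Suc n)) + A *v err \<omega> (Suc n)" "A *v err \<omega> (Suc n)"] e2 by simp
      also have "\<dots> \<le> 2 * \<theta> * \<gamma> * norm (A *v (x \<omega> 0 - xs)) + C2 * r" using b1 by (simp add: NA)
      also have "norm (A *v (x \<omega> 0 - xs)) \<le> norm (residual g (x \<omega> 0)) + C3 * r"
        using norm_triangle_ineq4[of "residual g (x \<omega> 0) + A *v (x \<omega> 0 - xs)" "residual g (x \<omega> 0)"] e3 by simp
      also have "2 * \<theta> * \<gamma> * (norm (residual g (x \<omega> 0)) + C3 * r) =
          2 * \<theta> * \<gamma> * norm (residual g (x \<omega> 0)) + 2 * (\<theta> * \<gamma>) * (C3 * r)" by (simp add: algebra_simps)
      also have "2 * (\<theta> * \<gamma>) * (C3 * r) \<le> 2 * 1 * (C3 * r)"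
        using mult_le_one[of \<theta> \<gamma>] \<theta> \<gamma> nn by (intro mult_right_mono mult_left_mono) auto
      finally show ?thesis
        unfolding R using nn \<theta> \<gamma> by (simp add: mult_left_mono)
    qed
    moreover have "norm (x \<omega> (Suc n) - xs) \<le> R" if "n = CARD('n)"
      using e1 b3[OF that] nn unfolding R by simp
    ultimately show ?case
      using N b1 b2
      unfolding cycle_bounds_def Let_def \<theta>_def[symmetric] \<gamma>_def[symmetric] R_def[symmetric] N_def
      by auto
  qed
  then show ?thesis ..
qed

end

context spd_matrix
begin

text \<open>
  The constants for a fixed length come from the filter of all admissible cycles of that length with
  initial error tending to zero; finitely many lengths then have common constants.
\<close>

lemma uniform_cycle_bounds:
  fixes g :: "real^'n \<Rightarrow> real^'n"
  assumes lin: "\<forall>z\<in>cball xs \<rho>. norm (residual g z + A *v (z - xs)) \<le> K * (norm (z - xs))\<^sup>2"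
    and pos: "0 < \<rho>" "0 < \<tau>" and \<theta>: "\<theta> < 1"
  shows "\<exists>\<epsilon>>0. \<exists>C>0. \<forall>n\<le>m. \<forall>\<beta> x P Q.
    (\<forall>i. 0 < \<beta> i \<and> spectral_norm (mat 1 - \<beta> i *\<^sub>R A) \<le> \<theta>) \<longrightarrow>
    restart_free ty g \<tau> \<beta> x P Q n \<longrightarrow> 0 < norm (x 0 - xs) \<longrightarrow> norm (x 0 - xs) \<le> \<epsilon> \<longrightarrow>
    cycle_bounds ty A \<mu> L g xs C \<beta> x n"
proof -
  let ?ok = "\<lambda>(\<beta> :: nat \<Rightarrow> real). \<forall>i. 0 < \<beta> i \<and> spectral_norm (mat 1 - \<beta> i *\<^sub>R A) \<le> \<theta>"
  define good where "good \<epsilon> C n \<longleftrightarrow> (\<forall>\<beta> x P Q. ?ok \<beta> \<longrightarrow>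
      restart_free ty g \<tau> \<beta> x P Q n \<longrightarrow> 0 < norm (x 0 - xs) \<longrightarrow> norm (x 0 - xs) \<le> \<epsilon> \<longrightarrow>
      cycle_bounds ty A \<mu> L g xs C \<beta> x n)" for \<epsilon> C n
  have good_mono: "good \<epsilon>' C' n" if "good \<epsilon> C n" "\<epsilon>' \<le> \<epsilon>" "C \<le> C'" for \<epsilon> C \<epsilon>' C' n
    using that unfolding good_def by (meson cycle_bounds_mono order_trans)
  have single: "\<exists>\<epsilon>>0. \<exists>C>0. good \<epsilon> C n" for n
  proof -
    \<comment> \<open>A cycle is encoded by its mixing parameters, iterates and pairs of directions.\<close>
    define \<Omega> where "\<Omega> = {(\<beta>, x, P, Q). ?ok \<beta> \<and> restart_free ty g \<tau> \<beta> x P Q n}"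
    define E where "E = (\<lambda>(\<beta> :: nat \<Rightarrow> real, x, P :: nat \<Rightarrow> real^'n, Q :: nat \<Rightarrow> real^'n). norm (x (0::nat) - xs))"
    define F where "F = inf (filtercomap E (at_right 0)) (principal \<Omega>)"
    have ev\<Omega>: "eventually (\<lambda>\<omega>. \<omega> \<in> \<Omega>) F"
      unfolding F_def by (simp add: eventually_inf_principal)
    interpret perturbed_cycle F E A \<mu> L ty g xs \<rho> K \<tau> "(1 - \<theta>) / L" "(1 + \<theta>) / \<mu>"
      "\<lambda>(\<beta>, x, P, Q). \<beta>" "\<lambda>(\<beta>, x, P, Q). x" "\<lambda>(\<beta>, x, P, Q). P" "\<lambda>(\<beta>, x, P, Q). Q" n
    proof (unfold_locales)
      show "filterlim E (at_right 0) F"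
        unfolding F_def by (rule filterlim_mono[OF filterlim_filtercomap]) auto
      show "0 < \<rho>" "0 < \<tau>" by (rule pos)+
      show "0 < (1 - \<theta>) / L" using \<theta> \<mu>_pos \<mu>_le_L by simp
      show "\<forall>\<^sub>F \<omega> in F. \<forall>i. (1 - \<theta>) / L \<le> (case \<omega> of (\<beta>, x, P, Q) \<Rightarrow> \<beta>) i \<and>
          (case \<omega> of (\<beta>, x, P, Q) \<Rightarrow> \<beta>) i \<le> (1 + \<theta>) / \<mu>"
        using ev\<Omega> by (rule eventually_mono) (auto simp: \<Omega>_def intro!: mixing_bounds)
      show "\<forall>\<^sub>F \<omega> in F. restart_free ty g \<tau> (case \<omega> of (\<beta>, x, P, Q) \<Rightarrow> \<beta>) (case \<omega> of (\<beta>, x, P, Q) \<Rightarrow> x)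
          (case \<omega> of (\<beta>, x, P, Q) \<Rightarrow> P) (case \<omega> of (\<beta>, x, P, Q) \<Rightarrow> Q) n"
        using ev\<Omega> by (rule eventually_mono) (auto simp: \<Omega>_def)
    qed (auto simp: E_def lin split: prod.splits)
    have "\<forall>\<^sub>F \<omega> in F. \<forall>i. 0 < (case \<omega> of (\<beta>, x, P, Q) \<Rightarrow> \<beta>) i \<and>
        spectral_norm (mat 1 - (case \<omega> of (\<beta>, x, P, Q) \<Rightarrow> \<beta>) i *\<^sub>R A) \<le> 1"
      using ev\<Omega> by (rule eventually_mono) (use \<theta> in \<open>auto simp: \<Omega>_def intro: order_trans less_imp_le\<close>)
    then obtain C where "\<forall>\<^sub>F \<omega> in F. cycle_bounds ty A \<mu> L g xs C (case \<omega> of (\<beta>, x, P, Q) \<Rightarrow> \<beta>)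
        (case \<omega> of (\<beta>, x, P, Q) \<Rightarrow> x) n"
      using eventually_cycle_bounds by blast
    then obtain S where S: "eventually S (at_right (0::real))"
      "\<And>\<omega>. S (E \<omega>) \<Longrightarrow> \<omega> \<in> \<Omega> \<Longrightarrow> cycle_bounds ty A \<mu> L g xs C (case \<omega> of (\<beta>, x, P, Q) \<Rightarrow> \<beta>)
        (case \<omega> of (\<beta>, x, P, Q) \<Rightarrow> x) n"
      unfolding F_def eventually_inf_principal eventually_filtercomap by blast
    then obtain b where b: "b > 0" "\<And>y. 0 < y \<Longrightarrow> y < b \<Longrightarrow> S y"
      by (auto simp: eventually_at_right_field)
    have "good (b/2) C n"
      unfolding good_def
    proof (intro allI impI)
      fix \<beta> x P Q
      assume "?ok \<beta>" "restart_free ty g \<tau> \<beta> x P Q n" "0 < norm (x 0 - xs)" "norm (x 0 - xs) \<le> b / 2"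
      then show "cycle_bounds ty A \<mu> L g xs C \<beta> x n"
        using S(2)[of "(\<beta>, x, P, Q)"] b by (simp add: \<Omega>_def E_def)
    qed
    then have "good (b/2) (max 1 C) n" by (rule good_mono) simp_all
    moreover have "0 < b/2" "0 < max 1 C" using b(1) by simp_all
    ultimately show ?thesis by blast
  qed
  have "\<exists>\<epsilon>>0. \<exists>C>0. \<forall>n\<le>m. good \<epsilon> C n"
  proof (induction m)
    case 0
    then show ?case using single[of 0] by simp
  next
    case (Suc m)
    obtain \<epsilon>1 C1 where 1: "\<epsilon>1 > 0" "C1 > 0" "\<And>n. n \<le> m \<Longrightarrow> good \<epsilon>1 C1 n"
      using Suc by blast
    obtain \<epsilon>2 C2 where 2: "\<epsilon>2 > 0" "C2 > 0" "good \<epsilon>2 C2 (Suc m)"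
      using single[of "Suc m"] by blast
    have "good (min \<epsilon>1 \<epsilon>2) (max C1 C2) n" if "n \<le> Suc m" for n
    proof (cases "n = Suc m")
      case True
      then show ?thesis using 2(3) by (auto intro: good_mono)
    next
      case False
      then show ?thesis using good_mono[OF 1(3)[of n]] that by simp
    qed
    moreover have "0 < min \<epsilon>1 \<epsilon>2" "0 < max C1 C2" using 1(1,2) 2(1,2) by simp_all
    ultimately show ?case by blast
  qed
  then show ?thesis unfolding good_def by blast
qed

end

section \<open>The cycles of a run\<close>

lemma reduce_pair_zero [simp]: "reduce_pair ty 0 0 z = z"
  by (cases z) (simp add: reduce_pair_def)

text \<open>
  Both loops of the method have this shape: the projection of \<open>x\<^sub>k\<close> with \<open>i = m\<^sub>k\<close>, and the
  orthogonalisation of \<open>p\<^sub>k\<close> with \<open>i = m\<^sub>k - 1\<close>.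
\<close>

lemma fold_reduce_pair:
  "fold (\<lambda>j. reduce_pair ty (p (s + j)) (q (s + j))) [max 1 (i - 1)..<i + 1] z =
   project ty (\<lambda>j. if j = 0 then 0 else p (s + j)) (\<lambda>j. if j = 0 then 0 else q (s + j)) i z"
proof -
  consider "i = 0" | "i = 1" | k where "i = Suc (Suc k)"
    by (metis One_nat_def not0_implies_Suc)
  then show ?thesis
  proof cases
    case 3
    then have "[max 1 (i - 1)..<i + 1] = [Suc k, Suc (Suc k)]" by (simp add: upt_rec)
    then show ?thesis using 3 by (simp add: project_def)
  qed (simp_all add: project_def upt_rec)
qed

lemma restart_free_0:
  assumes "P 0 = 0" "Q 0 = 0" "x (Suc 0) = x 0 + \<beta> 0 *\<^sub>R residual g (x 0)"
  shows "restart_free ty g \<tau> \<beta> x P Q 0"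
  using assms by (simp add: restart_free_def project_def)

lemma restart_free_Suc:
  assumes free: "restart_free ty g \<tau> \<beta> x P Q n"
    and PQ: "(P (Suc n), Q (Suc n)) =
        project ty P Q n (x (Suc n) - x n, residual g (x (Suc n)) - residual g (x n))"
    and den: "\<tau> * \<bar>v_vec ty (P 1) (Q 1) \<bullet> Q 1\<bar> \<le> \<bar>v_vec ty (P (Suc n)) (Q (Suc n)) \<bullet> Q (Suc n)\<bar>"
    and next_x: "let (xb, rb) = project ty P Q (Suc n) (x (Suc n), residual g (x (Suc n)))
         in x (Suc (Suc n)) = xb + \<beta> (Suc n) *\<^sub>R rb"
  shows "restart_free ty g \<tau> \<beta> x P Q (Suc n)"
  unfolding restart_free_def
proof (intro conjI allI impI)
  show "P 0 = 0" "Q 0 = 0" using free by (simp_all add: restart_free_def)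
next
  fix i assume "i \<le> Suc n"
  then have "i \<le> n \<or> i = Suc n" by linarith
  then show "let (xb, rb) = project ty P Q i (x i, residual g (x i)) in x (Suc i) = xb + \<beta> i *\<^sub>R rb"
    using free next_x unfolding restart_free_def by blast
next
  fix i assume "i < Suc n"
  then have "i < n \<or> i = n" by linarith
  then show "(P (Suc i), Q (Suc i)) =
      project ty P Q i (x (Suc i) - x i, residual g (x (Suc i)) - residual g (x i))"
    using free PQ unfolding restart_free_def by blast
next
  fix i assume "1 \<le> i \<and> i \<le> Suc n"
  then have "1 \<le> i \<and> i \<le> n \<or> i = Suc n" by linarith
  then show "\<tau> * \<bar>v_vec ty (P 1) (Q 1) \<bullet> Q 1\<bar> \<le> \<bar>v_vec ty (P i) (Q i) \<bullet> Q i\<bar>"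
    using free den unfolding restart_free_def by blast
qed

lemma st_am_iteration_restart:
  assumes "st_am_iteration ty g m \<tau> \<eta> \<beta> x p q M k" "M k = 0"
  shows "x (Suc k) = x k + \<beta> k *\<^sub>R residual g (x k)"
proof -
  let ?s = "k - M k"
  have "let (xbar, rbar) = fold (\<lambda>j. reduce_pair ty (p (?s + j)) (q (?s + j)))
      [max 1 (M k - 1)..<M k + 1] (x k, residual g (x k)) in x (k + 1) = xbar + \<beta> k *\<^sub>R rbar"
    using assms(1) unfolding st_am_iteration_def Let_def by (elim conjE)
  then show ?thesis using assms(2) by simp
qed

lemma st_am_iteration_continue:
  assumes it: "st_am_iteration ty g m \<tau> \<eta> \<beta> x p q M k" and Mk: "M k = Suc n"
  shows "0 < k \<and> M (k - 1) = n" and "Suc n \<le> m"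
    and "(p k, q k) = fold (\<lambda>j. reduce_pair ty (p (k - Suc n + j)) (q (k - Suc n + j)))
      [max 1 (n - 1)..<n + 1] (x k - x (k - 1), residual g (x k) - residual g (x (k - 1)))"
    and "\<tau> * \<bar>v_vec ty (p (k - Suc n + 1)) (q (k - Suc n + 1)) \<bullet> q (k - Suc n + 1)\<bar> \<le> \<bar>v_vec ty (p k) (q k) \<bullet> q k\<bar>"
    and "let (xbar, rbar) = fold (\<lambda>j. reduce_pair ty (p (k - Suc n + j)) (q (k - Suc n + j)))
      [max 1 (Suc n - 1)..<Suc n + 1] (x k, residual g (x k)) in x (Suc k) = xbar + \<beta> k *\<^sub>R rbar"
proof -
  define m0 where "m0 = (if k = 0 then 0 else M (k - 1) + 1)"
  define m1 where "m1 = (if m0 > m \<or> norm (residual g (x k)) > \<eta> * norm (residual g (x (k - m0))) then 0 else m0)"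
  note it' = it[unfolded st_am_iteration_def Let_def, folded m0_def, folded m1_def]
  have M: "M k = (if m1 > 0 \<and> \<bar>v_vec ty (p k) (q k) \<bullet> q k\<bar> < \<tau> * \<bar>v_vec ty (p (k - m1 + 1)) (q (k - m1 + 1)) \<bullet> q (k - m1 + 1)\<bar>
               then 0 else m1)"
    using it' by (elim conjE)
  have m1: "m1 = Suc n" using M Mk by (cases "m1 = 0") (simp_all split: if_splits)
  then have m0: "m0 = Suc n" "Suc n \<le> m" unfolding m1_def by (simp_all split: if_splits)
  then show "0 < k \<and> M (k - 1) = n" "Suc n \<le> m" unfolding m0_def by (simp_all split: if_splits)
  have "m1 > 0 \<longrightarrow> (p k, q k) = fold (\<lambda>j. reduce_pair ty (p (k - m1 + j)) (q (k - m1 + j)))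
      [max 1 (m1 - 2)..<m1] (x k - x (k - 1), residual g (x k) - residual g (x (k - 1)))"
    using it' by (elim conjE)
  moreover have "Suc n - 2 = n - 1" by simp
  ultimately show "(p k, q k) = fold (\<lambda>j. reduce_pair ty (p (k - Suc n + j)) (q (k - Suc n + j)))
      [max 1 (n - 1)..<n + 1] (x k - x (k - 1), residual g (x k) - residual g (x (k - 1)))"
    unfolding m1 Suc_eq_plus1 by simp
  show "\<tau> * \<bar>v_vec ty (p (k - Suc n + 1)) (q (k - Suc n + 1)) \<bullet> q (k - Suc n + 1)\<bar> \<le> \<bar>v_vec ty (p k) (q k) \<bullet> q k\<bar>"
    using M[unfolded m1 Mk] by (auto split: if_splits)
  show "let (xbar, rbar) = fold (\<lambda>j. reduce_pair ty (p (k - Suc n + j)) (q (k - Suc n + j)))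
      [max 1 (Suc n - 1)..<Suc n + 1] (x k, residual g (x k)) in x (Suc k) = xbar + \<beta> k *\<^sub>R rbar"
    using it'[unfolded Mk] unfolding Let_def Suc_eq_plus1[of k] by (elim conjE)
qed

text \<open>
  The loops of a cycle refer to the pairs after its start \<open>s\<close> only, so the pair \<open>(p s, q s)\<close> can be
  replaced by zero. In the induction step, iteration \<open>k\<close> continues the cycle of iteration \<open>k - 1\<close>.
\<close>

lemma st_am_run_restart_free:
  assumes run: "st_am_run ty g m \<tau> \<eta> \<beta> x p q M" and "performed g x k"
  defines "s \<equiv> k - M k"
  shows "M k \<le> k \<and> M k \<le> m \<and> restart_free ty g \<tau> (\<lambda>i. \<beta> (s + i)) (\<lambda>i. x (s + i))
      (\<lambda>i. if i = 0 then 0 else p (s + i)) (\<lambda>i. if i = 0 then 0 else q (s + i)) (M k)"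
  using assms(2) unfolding s_def
proof (induction "M k" arbitrary: k)
  case 0
  have it: "st_am_iteration ty g m \<tau> \<eta> \<beta> x p q M k" using run 0 by (simp add: st_am_run_def)
  show ?case
    unfolding 0(1)[symmetric] by (auto intro!: restart_free_0 simp: st_am_iteration_restart[OF it 0(1)[symmetric]])
next
  case (Suc n)
  have it: "st_am_iteration ty g m \<tau> \<eta> \<beta> x p q M k" using run Suc by (simp add: st_am_run_def)
  note step = st_am_iteration_continue[OF it Suc(2)[symmetric]]
  define s where "s = k - Suc n"
  have perf: "performed g x (k - 1)" using Suc.prems by (auto simp: performed_def)
  have n: "n = M (k - 1)" using step(1) by simp
  have IH: "n \<le> k - 1 \<and> n \<le> m \<and> restart_free ty g \<tau> (\<lambda>i. \<beta> (k - 1 - n + i)) (\<lambda>i. x (k - 1 - n + i))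
      (\<lambda>i. if i = 0 then 0 else p (k - 1 - n + i)) (\<lambda>i. if i = 0 then 0 else q (k - 1 - n + i)) n"
    using Suc.hyps(1)[OF n perf] unfolding n[symmetric] .
  have k: "k = s + Suc n" "k - 1 - n = s" "k - 1 = s + n" using IH step(1) by (auto simp: s_def)
  note step = step[folded s_def, unfolded fold_reduce_pair]
  have sk: "s + Suc n = k" "s + n = k - 1" "s + Suc (Suc n) = Suc k" using k by simp_all
  have free: "restart_free ty g \<tau> (\<lambda>i. \<beta> (s + i)) (\<lambda>i. x (s + i))
      (\<lambda>i. if i = 0 then 0 else p (s + i)) (\<lambda>i. if i = 0 then 0 else q (s + i)) n"
    using IH unfolding k(2) by blast
  have "restart_free ty g \<tau> (\<lambda>i. \<beta> (s + i)) (\<lambda>i. x (s + i))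
      (\<lambda>i. if i = 0 then 0 else p (s + i)) (\<lambda>i. if i = 0 then 0 else q (s + i)) (Suc n)"
    by (rule restart_free_Suc[OF free]) (use step in \<open>simp_all only: sk nat.distinct one_neq_zero if_False\<close>)
  then show ?case unfolding Suc(2)[symmetric] s_def using k(1) step(2) by simp
qed

context spd_matrix
begin

text \<open>
  If the error at the start of a cycle has norm at most \<open>\<delta>\<close>, the second-order term is absorbed
  by the gap between \<open>\<theta>\<close> and 1, and the energy norm does not increase over the cycle. By induction all
  cycles of the run start within radius \<open>\<delta>\<close>. The induction jumps from an iterate to the start of the
  cycle that produced it, because the second-order terms are measured by the error at that start.
\<close>

lemma st_am_run_cycle_bounds:
  fixes g :: "real^'n \<Rightarrow> real^'n"
  assumes lin: "\<forall>z\<in>cball xs \<rho>. norm (residual g z + A *v (z - xs)) \<le> K * (norm (z - xs))\<^sup>2"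
    and pos: "0 < \<rho>" "0 < \<tau>" and \<theta>: "\<theta> < 1" and root: "residual g xs = 0"
  shows "\<exists>\<epsilon>>0. \<exists>C>0. \<forall>\<beta> x p q M.
    norm (x 0 - xs) \<le> \<epsilon> \<longrightarrow>
    (\<forall>k. 0 < \<beta> k \<and> spectral_norm (mat 1 - \<beta> k *\<^sub>R A) \<le> \<theta>) \<longrightarrow>
    st_am_run ty g m \<tau> \<eta> \<beta> x p q M \<longrightarrow>
    (\<forall>k. performed g x k \<longrightarrow> M k \<le> k \<and>
      cycle_bounds ty A \<mu> L g xs C (\<lambda>i. \<beta> (k - M k + i)) (\<lambda>i. x (k - M k + i)) (M k))"
proof -
  obtain \<epsilon>1 C where \<epsilon>1: "\<epsilon>1 > 0" and C: "C > 0" and bounds: "\<forall>n\<le>m. \<forall>\<beta> x P Q.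
    (\<forall>i. 0 < \<beta> i \<and> spectral_norm (mat 1 - \<beta> i *\<^sub>R A) \<le> \<theta>) \<longrightarrow>
    restart_free ty g \<tau> \<beta> x P Q n \<longrightarrow> 0 < norm (x 0 - xs) \<longrightarrow> norm (x 0 - xs) \<le> \<epsilon>1 \<longrightarrow>
    cycle_bounds ty A \<mu> L g xs C \<beta> x n"
    using uniform_cycle_bounds[OF lin pos \<theta>, of m ty] by (elim exE conjE) (rule that)
  obtain c0 where c0: "c0 > 0" "\<And>u. c0 * (norm u)\<^sup>2 \<le> energy_form ty A u u"
    using energy_form_lower[of ty] by blast
  obtain c1 where c1: "c1 > 0" "\<And>u. energy_form ty A u u \<le> c1 * (norm u)\<^sup>2"
    using energy_form_upper[of ty] by blast
  define N where "N u = sqrt (energy_form ty A u u)" for u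
  have N_lower: "sqrt c0 * norm u \<le> N u" and N_upper: "N u \<le> sqrt c1 * norm u" for u
    using real_sqrt_le_mono[OF c0(2)[of u]] real_sqrt_le_mono[OF c1(2)[of u]]
    by (simp_all add: N_def real_sqrt_mult)
  \<comment> \<open>Within radius \<open>\<delta>\<close>, \<open>C |u|\<^sup>2\<close> is at most \<open>(1 - \<theta>) sqrt c0 |u|\<close>, hence at most \<open>(1 - \<theta>) N u\<close>.\<close>
  define \<delta> where "\<delta> = min \<epsilon>1 ((1 - \<theta>) * sqrt c0 / C)"
  have \<delta>: "\<delta> > 0" "\<delta> \<le> \<epsilon>1" "C * \<delta> \<le> (1 - \<theta>) * sqrt c0"
  proof -
    show "\<delta> > 0" "\<delta> \<le> \<epsilon>1" using \<epsilon>1 C \<theta> c0(1) by (simp_all add: \<delta>_def)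
    have "\<delta> \<le> (1 - \<theta>) * sqrt c0 / C" by (simp add: \<delta>_def)
    then show "C * \<delta> \<le> (1 - \<theta>) * sqrt c0" using C by (simp add: field_simps)
  qed
  have absorb: "\<theta> * N u + C * (norm u)\<^sup>2 \<le> N u" if "norm u \<le> \<delta>" for u
  proof -
    have "C * (norm u)\<^sup>2 \<le> C * \<delta> * norm u"
      using that C by (simp add: power2_eq_square mult_right_mono)
    also have "\<dots> \<le> (1 - \<theta>) * sqrt c0 * norm u" using \<delta>(3) by (intro mult_right_mono) auto
    also have "\<dots> \<le> (1 - \<theta>) * N u"
      using mult_left_mono[OF N_lower[of u], of "1 - \<theta>"] \<theta> by (simp add: mult.assoc)
    finally show ?thesis by (simp add: algebra_simps)
  qed
  \<comment> \<open>The factor relates the Euclidean and the energy norm, in which the iterates stay bounded.\<close>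
  define \<epsilon> where "\<epsilon> = \<delta> * sqrt c0 / sqrt c1"
  have \<epsilon>: "\<epsilon> > 0" using \<delta> c0 c1 by (simp add: \<epsilon>_def)
  have "\<forall>k. performed g x k \<longrightarrow> M k \<le> k \<and>
      cycle_bounds ty A \<mu> L g xs C (\<lambda>i. \<beta> (k - M k + i)) (\<lambda>i. x (k - M k + i)) (M k)"
    if x0: "norm (x 0 - xs) \<le> \<epsilon>"
      and \<beta>: "\<forall>k. 0 < \<beta> k \<and> spectral_norm (mat 1 - \<beta> k *\<^sub>R A) \<le> \<theta>"
      and run: "st_am_run ty g m \<tau> \<eta> \<beta> x p q M" for \<beta> x p q M
  proof -
    have near: "norm u \<le> \<delta>" if "N u \<le> N (x 0 - xs)" for u
    proof -
      have start: "sqrt c1 * norm (x 0 - xs) \<le> sqrt c1 * \<epsilon>"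
        by (rule mult_left_mono[OF x0]) (use c1(1) in simp)
      have "sqrt c0 * norm u \<le> sqrt c1 * \<epsilon>"
        using N_lower[of u] that N_upper[of "x 0 - xs"] start by linarith
      also have "\<dots> = sqrt c0 * \<delta>" using c1(1) by (simp add: \<epsilon>_def)
      finally show ?thesis using c0(1) by simp
    qed
    have bound: "M k \<le> k \<and> cycle_bounds ty A \<mu> L g xs C (\<lambda>i. \<beta> (k - M k + i)) (\<lambda>i. x (k - M k + i)) (M k)"
      if k: "performed g x k" and start: "N (x (k - M k) - xs) \<le> N (x 0 - xs)" for k
    proof -
      have "x (k - M k) \<noteq> xs" using k root by (auto simp: performed_def)
      then have away: "0 < norm (x (k - M k + 0) - xs)" by simp
      have close: "norm (x (k - M k + 0) - xs) \<le> \<epsilon>1" using near[OF start] \<delta>(2) by simp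
      note free = st_am_run_restart_free[OF run k]
      show ?thesis
      proof
        show "M k \<le> k" using free by blast
        show "cycle_bounds ty A \<mu> L g xs C (\<lambda>i. \<beta> (k - M k + i)) (\<lambda>i. x (k - M k + i)) (M k)"
        proof (rule bounds[rule_format])
          show "restart_free ty g \<tau> (\<lambda>i. \<beta> (k - M k + i)) (\<lambda>i. x (k - M k + i))
              (\<lambda>i. if i = 0 then 0 else p (k - M k + i)) (\<lambda>i. if i = 0 then 0 else q (k - M k + i)) (M k)"
            using free by blast
        qed (use free \<beta> away close in blast)+
      qed
    qed
    have decrease: "N (x k - xs) \<le> N (x 0 - xs)" if "\<forall>j<k. performed g x j" for k
      using that
    proof (induction k rule: less_induct)
      case (less k)
      show ?case
      proof (cases k)
        case (Suc j)
        have j: "performed g x j" using less.prems Suc by simp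
        define s where "s = j - M j"
        have "N (x s - xs) \<le> N (x 0 - xs)" using less.IH[of s] less.prems Suc by (simp add: s_def)
        then have s: "norm (x s - xs) \<le> \<delta>" and b: "M j \<le> j"
          "cycle_bounds ty A \<mu> L g xs C (\<lambda>i. \<beta> (s + i)) (\<lambda>i. x (s + i)) (M j)"
          using near bound[OF j] by (auto simp: s_def)
        have "s + M j = j" using b(1) by (simp add: s_def)
        then have "N (x k - xs) \<le> spectral_norm (mat 1 - \<beta> j *\<^sub>R A) * N (x s - xs) + C * (norm (x s - xs))\<^sup>2"
          using b(2) Suc by (simp add: cycle_bounds_def Let_def N_def)
        also have "\<dots> \<le> \<theta> * N (x s - xs) + C * (norm (x s - xs))\<^sup>2"
          using \<beta> order_trans[OF _ N_lower[of "x s - xs"], of 0] c0(1) by (intro add_right_mono mult_right_mono) auto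
        also have "\<dots> \<le> N (x s - xs)" by (rule absorb[OF s])
        also have "\<dots> \<le> N (x 0 - xs)" by fact
        finally show ?thesis .
      qed simp
    qed
    show ?thesis
    proof (intro allI impI)
      fix k assume k: "performed g x k"
      have "\<forall>j<k - M k. performed g x j" using k by (auto simp: performed_def)
      from bound[OF k decrease[OF this]]
      show "M k \<le> k \<and> cycle_bounds ty A \<mu> L g xs C (\<lambda>i. \<beta> (k - M k + i)) (\<lambda>i. x (k - M k + i)) (M k)" .
    qed
  qed
  then show ?thesis using \<epsilon> C by blast
qed

end

section \<open>Convergence of the restarted method\<close>

lemma jacobian_id_minus:
  fixes g :: "real^'n \<Rightarrow> real^'n"
  assumes "h = (\<lambda>x. x - g x)" "h differentiable (at a)"
  shows "jacobian h (at a) = mat 1 - jacobian g (at a)"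
proof -
  have h: "(h has_derivative (\<lambda>v. jacobian h (at a) *v v)) (at a)"
    using assms(2) by (simp add: jacobian_works)
  have "((\<lambda>x. x - h x) has_derivative (\<lambda>v. v - jacobian h (at a) *v v)) (at a)"
    by (intro has_derivative_diff has_derivative_ident h)
  moreover have "(\<lambda>x. x - h x) = g" by (simp add: assms(1))
  ultimately have g: "(g has_derivative (\<lambda>v. v - jacobian h (at a) *v v)) (at a)" by simp
  then have "g differentiable (at a)" by (auto simp: differentiable_def)
  then have "(g has_derivative (\<lambda>v. jacobian g (at a) *v v)) (at a)" by (simp add: jacobian_works)
  from has_derivative_unique[OF this g] have "jacobian g (at a) *v v = v - jacobian h (at a) *v v" for v
    by metis
  then have "(mat 1 - jacobian g (at a)) *v v = jacobian h (at a) *v v" for v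
    by (simp add: matrix_vector_mult_diff_rdistrib)
  then show ?thesis by (metis matrix_eq)
qed

theorem theorem6p2:
  fixes g h :: "real^'d \<Rightarrow> real^'d" and xs :: "real^'d" and U :: "(real^'d) set"
    and A :: "real^'d^'d" and \<rho> \<kappa> \<mu> L \<theta> \<tau> \<eta> :: real and m :: nat
  assumes h: "h = (\<lambda>x. x - g x)"
    and H: "assumption_H h xs U"
    and sym: "\<forall>x\<in>U. transpose (jacobian g (at x)) = jacobian g (at x)"
    and const_bounds: "local_constants h xs \<rho> \<kappa> \<mu> L"
    and A: "A = mat 1 - jacobian g (at xs)"
    and m: "0 < m" "m \<le> CARD('d)"
    and \<tau>: "0 < \<tau>" "\<tau> < 1"
    and \<eta>: "0 < \<eta>"
    and \<theta>: "(L - \<mu>) / (L + \<mu>) \<le> \<theta>" "\<theta> < 1"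
  shows
    "(\<exists>\<epsilon>>0. \<exists>C>0. \<forall>\<beta> x p q M.
        norm (x 0 - xs) \<le> \<epsilon> \<longrightarrow>
        (\<forall>k. 0 < \<beta> k \<and> spectral_norm (mat 1 - \<beta> k *\<^sub>R A) \<le> \<theta>) \<longrightarrow>
        st_am_run Type_I g m \<tau> \<eta> \<beta> x p q M \<longrightarrow>
        (\<forall>k. performed g x k \<longrightarrow>
          energy_norm A (x (k + 1) - xs)
            \<le> 2 * spectral_norm (mat 1 - \<beta> k *\<^sub>R A)
                * ((sqrt (L / \<mu>) - 1) / (sqrt (L / \<mu>) + 1)) ^ M k
                * energy_norm A (x (k - M k) - xs)
              + \<kappa> * (C * (norm (x (k - M k) - xs))\<^sup>2)))
     \<and>
     (\<exists>\<epsilon>>0. \<exists>C>0. \<forall>\<beta> x p q M.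
        norm (x 0 - xs) \<le> \<epsilon> \<longrightarrow>
        (\<forall>k. 0 < \<beta> k \<and> spectral_norm (mat 1 - \<beta> k *\<^sub>R A) \<le> \<theta>) \<longrightarrow>
        st_am_run Type_II g m \<tau> \<eta> \<beta> x p q M \<longrightarrow>
        (\<forall>k. performed g x k \<longrightarrow>
          norm (residual g (x (k + 1)))
            \<le> 2 * spectral_norm (mat 1 - \<beta> k *\<^sub>R A)
                * ((sqrt (L / \<mu>) - 1) / (sqrt (L / \<mu>) + 1)) ^ M k
                * norm (residual g (x (k - M k)))
              + \<kappa> * (C * (norm (x (k - M k) - xs))\<^sup>2)))
     \<and>
     (\<forall>ty. \<exists>\<epsilon>>0. \<exists>C>0. \<forall>\<beta> x p q M.
        norm (x 0 - xs) \<le> \<epsilon> \<longrightarrow>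
        (\<forall>k. 0 < \<beta> k \<and> spectral_norm (mat 1 - \<beta> k *\<^sub>R A) \<le> \<theta>) \<longrightarrow>
        st_am_run ty g m \<tau> \<eta> \<beta> x p q M \<longrightarrow>
        (\<forall>k. performed g x k \<and> M k = CARD('d) \<longrightarrow>
          norm (x (k + 1) - xs) \<le> \<kappa> * (C * (norm (x (k - M k) - xs))\<^sup>2)))"
proof -
  have pos: "0 < \<rho>" "0 < \<kappa>" "0 < \<mu>" and xs: "xs \<in> cball xs \<rho>"
    using const_bounds by (auto simp: local_constants_def)
  have A_h: "A = jacobian h (at xs)"
    unfolding A by (rule jacobian_id_minus[symmetric, OF h])
      (use const_bounds xs in \<open>auto simp: local_constants_def\<close>)
  have "xs \<in> U" using H by (simp add: assumption_H_def)
  then have "transpose A = A"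
    using sym unfolding A transpose_def by (simp add: vec_eq_iff mat_def)
  moreover have "\<mu> * (norm y)\<^sup>2 \<le> y \<bullet> (A *v y)" "y \<bullet> (A *v y) \<le> L * (norm y)\<^sup>2" for y
    using const_bounds xs unfolding local_constants_def A_h by auto
  ultimately interpret spd_matrix A \<mu> L using pos by unfold_locales
  have res: "residual g z = - h z" for z by (simp add: residual_def h)
  have lin: "\<forall>z\<in>cball xs \<rho>. norm (residual g z + A *v (z - xs)) \<le> (1/2 * \<kappa>) * (norm (z - xs))\<^sup>2"
  proof
    fix z assume "z \<in> cball xs \<rho>"
    then have "norm (h z - A *v (z - xs)) \<le> 1/2 * \<kappa> * (norm (z - xs))\<^sup>2"
      using const_bounds unfolding local_constants_def A_h by blast
    then show "norm (residual g z + A *v (z - xs)) \<le> (1/2 * \<kappa>) * (norm (z - xs))\<^sup>2" by (simp add: res norm_minus_commute)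
  qed
  have root: "residual g xs = 0" using H by (simp add: assumption_H_def res)
  have core: "\<exists>\<epsilon>>0. \<exists>C>0. \<forall>\<beta> x p q M.
      norm (x 0 - xs) \<le> \<epsilon> \<longrightarrow>
      (\<forall>k. 0 < \<beta> k \<and> spectral_norm (mat 1 - \<beta> k *\<^sub>R A) \<le> \<theta>) \<longrightarrow>
      st_am_run ty g m \<tau> \<eta> \<beta> x p q M \<longrightarrow>
      (\<forall>k. performed g x k \<longrightarrow> M k \<le> k \<and>
        cycle_bounds ty A \<mu> L g xs (\<kappa> * C) (\<lambda>i. \<beta> (k - M k + i)) (\<lambda>i. x (k - M k + i)) (M k))" for ty
  proof -
    obtain \<epsilon> C where \<epsilon>: "\<epsilon> > 0" and C: "C > 0" and b: "\<forall>\<beta> x p q M.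
      norm (x 0 - xs) \<le> \<epsilon> \<longrightarrow>
      (\<forall>k. 0 < \<beta> k \<and> spectral_norm (mat 1 - \<beta> k *\<^sub>R A) \<le> \<theta>) \<longrightarrow>
      st_am_run ty g m \<tau> \<eta> \<beta> x p q M \<longrightarrow>
      (\<forall>k. performed g x k \<longrightarrow> M k \<le> k \<and>
        cycle_bounds ty A \<mu> L g xs C (\<lambda>i. \<beta> (k - M k + i)) (\<lambda>i. x (k - M k + i)) (M k))"
      using st_am_run_cycle_bounds[OF lin pos(1) \<tau>(1) \<theta>(2) root, of ty m \<eta>] by (elim exE conjE) (rule that)
    \<comment> \<open>The factor \<open>\<kappa>\<close> of the error term is split off from the constant.\<close>
    obtain C' where C': "C' > 0" "C = \<kappa> * C'"
      using that[of "C / \<kappa>"] pos C by simp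
    show ?thesis using \<epsilon> C'(1) b unfolding C'(2) by blast
  qed
  have transfer: "\<exists>\<epsilon>>0. \<exists>C>0. \<forall>\<beta> x p q M.
      norm (x 0 - xs) \<le> \<epsilon> \<longrightarrow>
      (\<forall>k. 0 < \<beta> k \<and> spectral_norm (mat 1 - \<beta> k *\<^sub>R A) \<le> \<theta>) \<longrightarrow>
      st_am_run ty g m \<tau> \<eta> \<beta> x p q M \<longrightarrow>
      (\<forall>k. performed g x k \<longrightarrow> T C \<beta> x M k)"
    if T: "\<And>C \<beta> x M k. M k \<le> k \<Longrightarrow>
        cycle_bounds ty A \<mu> L g xs (\<kappa> * C) (\<lambda>i. \<beta> (k - M k + i)) (\<lambda>i. x (k - M k + i)) (M k) \<Longrightarrow>
      T C \<beta> x M k" for ty T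
    using core[of ty] by (elim ex_forward conj_forward all_forward imp_forward) (assumption | erule conjE | erule (1) T)+
  show ?thesis
    unfolding imp_conjL
  proof (intro conjI allI)
    fix ty
    note [simp] = cycle_bounds_def Let_def energy_norm_def energy_form_def mult.assoc
    show "\<exists>\<epsilon>>0. \<exists>C>0. \<forall>\<beta> x p q M.
        norm (x 0 - xs) \<le> \<epsilon> \<longrightarrow>
        (\<forall>k. 0 < \<beta> k \<and> spectral_norm (mat 1 - \<beta> k *\<^sub>R A) \<le> \<theta>) \<longrightarrow>
        st_am_run Type_I g m \<tau> \<eta> \<beta> x p q M \<longrightarrow>
        (\<forall>k. performed g x k \<longrightarrow>
          energy_norm A (x (k + 1) - xs)
            \<le> 2 * spectral_norm (mat 1 - \<beta> k *\<^sub>R A)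
                * ((sqrt (L / \<mu>) - 1) / (sqrt (L / \<mu>) + 1)) ^ M k
                * energy_norm A (x (k - M k) - xs)
              + \<kappa> * (C * (norm (x (k - M k) - xs))\<^sup>2))"
      by (rule transfer) simp
    show "\<exists>\<epsilon>>0. \<exists>C>0. \<forall>\<beta> x p q M.
        norm (x 0 - xs) \<le> \<epsilon> \<longrightarrow>
        (\<forall>k. 0 < \<beta> k \<and> spectral_norm (mat 1 - \<beta> k *\<^sub>R A) \<le> \<theta>) \<longrightarrow>
        st_am_run Type_II g m \<tau> \<eta> \<beta> x p q M \<longrightarrow>
        (\<forall>k. performed g x k \<longrightarrow>
          norm (residual g (x (k + 1)))
            \<le> 2 * spectral_norm (mat 1 - \<beta> k *\<^sub>R A)
                * ((sqrt (L / \<mu>) - 1) / (sqrt (L / \<mu>) + 1)) ^ M k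
                * norm (residual g (x (k - M k)))
              + \<kappa> * (C * (norm (x (k - M k) - xs))\<^sup>2))"
      by (rule transfer) simp
    show "\<exists>\<epsilon>>0. \<exists>C>0. \<forall>\<beta> x p q M.
        norm (x 0 - xs) \<le> \<epsilon> \<longrightarrow>
        (\<forall>k. 0 < \<beta> k \<and> spectral_norm (mat 1 - \<beta> k *\<^sub>R A) \<le> \<theta>) \<longrightarrow>
        st_am_run ty g m \<tau> \<eta> \<beta> x p q M \<longrightarrow>
        (\<forall>k. performed g x k \<longrightarrow> M k = CARD('d) \<longrightarrow>
          norm (x (k + 1) - xs) \<le> \<kappa> * (C * (norm (x (k - M k) - xs))\<^sup>2))"
      by (rule transfer) auto
  qed
qed

end
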